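(* For every closed System T term $t:(\iota\to\iota)\to\iota$, $$h(D(t))\le E_2^{K(t)+1}(\omega+m(t)),$$ where $E_2^0(\alpha)=\alpha$ and $E_2^{n+1}(\alpha)=2^{E_2^n(\alpha)}$ (ordinal exponentiation), $D(t)$ is the dialogue tree of $t$ with ordinal height $h(D(t))$, and $K(t)$, $m(t)$ are the natural numbers computed from the syntax of $t$ by $K(t)=B(t\,\Omega)$ and $m(t)=\mu(t\,\Omega)$, with $B$ and $\mu$ as defined in the context.
   Context: Ordinals are classical, with ordinary ordinal arithmetic. **System T.** Simple types: $\sigma,\tau::=\iota\mid\sigma\to\tau$ (arrows associate to the right). Terms are simply typed $\lambda$-terms (variables, abstractions, applications), up to renaming of bound variables, over the constants $\mathsf 0:\iota$, $\mathsf{succ}:\iota\to\iota$, and $\mathsf{Rec}_\sigma:(\iota\to\sigma\to\sigma)\to\sigma\to\iota\to\sigma$ for every type $\sigma$. Closed terms are terms in the empty context. The extended source language adds one further constant $\Omega:\iota\to\iota$. **Dialogue trees.** For a set $X$, $\mathcal D(X)$ is inductively generated by leaves $\eta(x)$ ($x\in X$) and nodes $\beta_i(\varphi)$ ($i\in\mathbb N$, $\varphi:\mathbb N\to\mathcal D(X)$). Height of $d\in\mathcal D(\mathbb N)$: $h(\eta(n))=0$, $h(\beta_i(\varphi))=\sup_{n\in\mathbb N}(h(\varphi(n))+1)$. Grafting, for $d\in\mathcal D(X)$ and $g:X\to\mathcal D(Y)$: $\eta(x)\gg\!\!=g\;=\;g(x)$ and $\beta_i(\varphi)\gg\!\!=g\;=\;\beta_i(n\mapsto\varphi(n)\gg\!\!=g)$.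 Put $\mathrm{map}(f,d)=d\gg\!\!=(x\mapsto\eta(f(x)))$. **Dialogue interpretation.** $V_\iota=\mathcal D(\mathbb N)$, $V_{\sigma\to\tau}=V_\sigma\to V_\tau$. A valuation $\gamma$ for a context $\Gamma$ assigns $\gamma(x)\in V_\sigma$ to each $x:\sigma$ in $\Gamma$. Typed grafting, for $d\in\mathcal D(X)$ and $g:X\to V_\sigma$: $d\gg\!\!=_\iota g=d\gg\!\!=g$, and $(d\gg\!\!=_{\sigma\to\tau}g)(a)=d\gg\!\!=_\tau(x\mapsto g(x)(a))$. $[\![t]\!]^D_\gamma\in V_\sigma$ is defined by $[\![x]\!]^D_\gamma=\gamma(x)$; $[\![\lambda x^\sigma.t]\!]^D_\gamma(a)=[\![t]\!]^D_{\gamma[x\mapsto a]}$; $[\![t\,u]\!]^D_\gamma=[\![t]\!]^D_\gamma([\![u]\!]^D_\gamma)$; $[\![\mathsf 0]\!]^D=\eta(0)$; $[\![\mathsf{succ}]\!]^D(d)=\mathrm{map}(n\mapsto n+1,d)$; $[\![\mathsf{Rec}_\sigma]\!]^D(f)(a)(d)=d\gg\!\!=_\sigma(n\mapsto v_n)$, where $v_0=a$ and $v_{n+1}=f(\eta(n))(v_n)$. With $\mathsf{gen}(d)=d\gg\!\!=(i\mapsto\beta_i(n\mapsto\eta(n)))$, set $D(t)=[\![t]\!]^D(\mathsf{gen})\in\mathcal D(\mathbb N)$ for closed $t:(\iota\to\iota)\to\iota$. **Type level.** $\mathrm{lev}(\iota)=0$, $\mathrm{lev}(\sigma\to\tau)=\max\{\mathrm{lev}(\sigma)+1,\mathrm{lev}(\tau)\}$.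 **Source ceiling $B$** (on extended source terms): $B(\mathsf 0)=0$; $B(\mathsf{succ})=B(\Omega)=1$; $B(x)=\mathrm{lev}(\sigma)$ for a variable $x:\sigma$; $B(\mathsf{Rec}_\sigma)=\mathrm{lev}((\iota\to\sigma\to\sigma)\to\sigma\to\iota\to\sigma)$; $B(\lambda x^\sigma.u)=\max\{\mathrm{lev}(\sigma\to\tau),B(u)\}$ for $u:\tau$; $B(u\,v)=\max\{\mathrm{lev}(\tau),B(u),B(v)\}$ for $u:\sigma\to\tau$, $v:\sigma$. **Source offset $\mu$** (on extended source terms): $\mu(x)=\mu(\mathsf 0)=0$; $\mu(\mathsf{succ})=2$; $\mu(\Omega)=3$; $\mu(\mathsf{Rec}_\sigma)=2k+4$ where $\sigma=\sigma_1\to\cdots\to\sigma_k\to\iota$; $\mu(\lambda x^\sigma.u)=\mu(u)+1$; $\mu(u\,v)=\max\{\mu(u),\mu(v)\}+1$. *)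

theory Defs
  imports "HOL-Library.Countable_Set" "HOL-Library.FuncSet"
begin

section \<open>Ordinals\<close>

subsection \<open>Constructions on well-orderings\<close>

lemma strict_mono_imp_ordLeq:
  assumes r: "Well_order r" and s: "Well_order s"
    and fld: "\<And>x. x \<in> Field r \<Longrightarrow> f x \<in> Field s"
    and mono: "\<And>x y. (x, y) \<in> r \<Longrightarrow> x \<noteq> y \<Longrightarrow> (f x, f y) \<in> s \<and> f x \<noteq> f y"
  shows "(r, s) \<in> ordLeq"
proof (rule ccontr)
  assume "(r, s) \<notin> ordLeq"
  then have "(s, r) \<in> ordLess"
    using r s not_ordLeq_iff_ordLess by blast
  then obtain a where a: "a \<in> Field r" and "(s, Restr r (underS r a)) \<in> ordIso"
    using ordLess_iff_ordIso_Restr[OF r s] by blast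
  then obtain g where g: "iso s (Restr r (underS r a)) g"
    unfolding ordIso_def by blast
  have F: "Field (Restr r (underS r a)) = underS r a"
    by (rule Field_Restr_ofilter[OF r wo_rel.underS_ofilter]) (simp add: wo_rel_def r)
  have bij: "bij_betw g (Field s) (underS r a)"
    using g F by (simp add: iso_def)
  have "embed s (Restr r (underS r a)) g" using g by (simp add: iso_def)
  then have comp: "compat s (Restr r (underS r a)) g"
    using s by (simp add: embed_compat)
  have gm: "(g x, g y) \<in> r" if "(x, y) \<in> s" for x y
    using comp that by (auto simp: compat_def)
  have gne: "g x \<noteq> g y" if "(x, y) \<in> s" "x \<noteq> y" for x y
    using bij that by (auto simp: bij_betw_def inj_on_def Field_def)
  have wf: "wf (r - Id)" using r by (simp add: well_order_on_def)
  have "x \<in> Field r \<longrightarrow> (g (f x), x) \<notin> r - Id" for x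
    using wf
  proof (induction x rule: wf_induct_rule)
    case (less x)
    show ?case
    proof (intro impI notI)
      assume x: "x \<in> Field r" and lt: "(g (f x), x) \<in> r - Id"
      then have "g (f x) \<in> Field r" by (auto simp: Field_def)
      with less lt have no: "(g (f (g (f x))), g (f x)) \<notin> r - Id" by blast
      have "(f (g (f x)), f x) \<in> s \<and> f (g (f x)) \<noteq> f x" using mono lt by auto
      with gm gne no show False by blast
    qed
  qed
  moreover have "g (f a) \<in> underS r a"
    using bij fld[OF a] by (auto simp: bij_betw_def)
  ultimately show False using a by (auto simp: underS_def)
qed

definition seq_sum :: "(nat \<Rightarrow> nat rel) \<Rightarrow> nat rel" where
  "seq_sum r = {(prod_encode (m, x), prod_encode (n, y)) | m x n y.
     x \<in> Field (r m) \<and> y \<in> Field (r n) \<and> (m < n \<or> m = n \<and> (x, y) \<in> r m)}"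

lemma seq_sum_iff:
  "(prod_encode (m, x), prod_encode (n, y)) \<in> seq_sum r \<longleftrightarrow>
     x \<in> Field (r m) \<and> y \<in> Field (r n) \<and> (m < n \<or> m = n \<and> (x, y) \<in> r m)"
  by (auto simp: seq_sum_def dest: prod_encode_eq[THEN iffD1])

lemma Field_seq_sum:
  assumes "\<And>n. Well_order (r n)"
  shows "Field (seq_sum r) = {prod_encode (n, x) | n x. x \<in> Field (r n)}"
proof -
  have "(prod_encode (n, x), prod_encode (n, x)) \<in> seq_sum r" if "x \<in> Field (r n)" for n x
    using assms[of n] that
    by (auto simp: seq_sum_iff order_on_defs refl_on_def)
  then show ?thesis
    by (fastforce simp: Field_def seq_sum_def)
qed

lemma Well_order_seq_sum:
  assumes wo: "\<And>n. Well_order (r n)"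
  shows "Well_order (seq_sum r)"
proof -
  note F = Field_seq_sum[of r, OF wo]
  have rr: "x \<in> Field (r n) \<Longrightarrow> (x, x) \<in> r n" for n x
    using wo[of n] by (auto simp: order_on_defs refl_on_def)
  have tr: "(x, y) \<in> r n \<Longrightarrow> (y, z) \<in> r n \<Longrightarrow> (x, z) \<in> r n" for n x y z
    using wo[of n] by (auto simp: order_on_defs elim: transE)
  have an: "(x, y) \<in> r n \<Longrightarrow> (y, x) \<in> r n \<Longrightarrow> x = y" for n x y
    using wo[of n] by (auto simp: order_on_defs dest: antisymD)
  have tot: "x \<in> Field (r n) \<Longrightarrow> y \<in> Field (r n) \<Longrightarrow> (x, y) \<in> r n \<or> (y, x) \<in> r n" for n x y
    using wo[of n] rr by (cases "x = y") (auto simp: order_on_defs total_on_def)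
  have ex: "\<exists>n x. p = prod_encode (n, x)" for p
    by (metis prod_decode_inverse surj_pair)
  have wfn: "wf (r n - Id)" for n
    using wo[of n] by (simp add: well_order_on_def)
  have "refl_on (Field (seq_sum r)) (seq_sum r)"
    using F by (auto simp: refl_on_def seq_sum_iff rr)
  moreover have "seq_sum r \<subseteq> Field (seq_sum r) \<times> Field (seq_sum r)"
    by (auto simp: Field_def)
  moreover have "trans (seq_sum r)"
  proof (rule transI)
    fix p q s assume *: "(p, q) \<in> seq_sum r" "(q, s) \<in> seq_sum r"
    obtain a b c d e f where "p = prod_encode (a, b)" "q = prod_encode (c, d)" "s = prod_encode (e, f)"
      using ex by metis
    with * show "(p, s) \<in> seq_sum r" by (auto simp: seq_sum_iff dest: tr)
  qed
  moreover have "antisym (seq_sum r)"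
  proof (rule antisymI)
    fix p q assume *: "(p, q) \<in> seq_sum r" "(q, p) \<in> seq_sum r"
    obtain a b c d where "p = prod_encode (a, b)" "q = prod_encode (c, d)"
      using ex by metis
    with * show "p = q" by (auto simp: seq_sum_iff dest: an)
  qed
  moreover have "total_on (Field (seq_sum r)) (seq_sum r)"
  proof (rule total_onI)
    fix p q assume *: "p \<in> Field (seq_sum r)" "q \<in> Field (seq_sum r)"
    then obtain a b c d where "p = prod_encode (a, b)" "q = prod_encode (c, d)"
      "b \<in> Field (r a)" "d \<in> Field (r c)"
      using F by auto
    then show "(p, q) \<in> seq_sum r \<or> (q, p) \<in> seq_sum r"
      using tot[of b a d] by (auto simp: seq_sum_iff)
  qed
  moreover have "wf (seq_sum r - Id)"
  proof (rule wfI_min)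
    fix p :: nat and Q assume "p \<in> Q"
    then obtain k where k: "\<exists>x. prod_encode (k, x) \<in> Q" using ex by metis
    define n where "n = (LEAST n. \<exists>x. prod_encode (n, x) \<in> Q)"
    have n: "\<exists>x. prod_encode (n, x) \<in> Q"
      unfolding n_def using k by (rule LeastI)
    have nmin: "\<not> m < n" if "prod_encode (m, x) \<in> Q" for m x
      using that not_less_Least unfolding n_def by blast
    from n obtain x0 where "x0 \<in> {x. prod_encode (n, x) \<in> Q}" by blast
    then obtain x where x: "prod_encode (n, x) \<in> Q"
      and xmin: "\<And>y. (y, x) \<in> r n - Id \<Longrightarrow> prod_encode (n, y) \<notin> Q"
      using wfE_min[OF wfn[of n]] by (metis mem_Collect_eq)
    show "\<exists>z\<in>Q. \<forall>y. (y, z) \<in> seq_sum r - Id \<longrightarrow> y \<notin> Q"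
    proof (intro bexI[OF _ x] allI impI)
      fix y assume y: "(y, prod_encode (n, x)) \<in> seq_sum r - Id"
      obtain a b where ab: "y = prod_encode (a, b)" using ex by metis
      with y show "y \<notin> Q" using nmin xmin by (auto simp: seq_sum_iff)
    qed
  qed
  ultimately show ?thesis by (simp add: order_on_defs)
qed

lemma ordLeq_seq_sum:
  assumes wo: "\<And>n. Well_order (r n)"
  shows "(r n, seq_sum r) \<in> ordLeq"
proof (rule strict_mono_imp_ordLeq[where f = "\<lambda>x. prod_encode (n, x)"])
  show "Well_order (r n)" "Well_order (seq_sum r)"
    using wo Well_order_seq_sum by blast+
  show "prod_encode (n, x) \<in> Field (seq_sum r)" if "x \<in> Field (r n)" for x
    using that by (auto simp: Field_seq_sum[OF wo])
  show "(prod_encode (n, x), prod_encode (n, y)) \<in> seq_sum r \<and> prod_encode (n, x) \<noteq> prod_encode (n, y)"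
    if "(x, y) \<in> r n" "x \<noteq> y" for x y
    using that by (auto simp: seq_sum_iff prod_encode_eq intro: FieldI1 FieldI2)
qed

text \<open>A strict upper bound of \<open>r\<close>: put one more element on top.\<close>

definition top_ext :: "nat rel \<Rightarrow> nat rel" where
  "top_ext r = seq_sum (\<lambda>n. if n = 0 then r else if n = 1 then {(0, 0)} else {})"

lemma Well_order_small: "Well_order ({} :: nat rel)" "Well_order {(0 :: nat, 0 :: nat)}"
  by (auto simp: order_on_defs refl_on_def Field_def total_on_def trans_def antisym_def)

lemma ordLess_top_ext:
  assumes r: "Well_order r"
  shows "(r, top_ext r) \<in> ordLess"
proof -
  let ?s = "\<lambda>n::nat. if n = 0 then r else if n = 1 then {(0, 0)} else {} :: nat rel"
  have wo: "Well_order (?s n)" for n using r Well_order_small by simp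
  let ?T = "seq_sum ?s"
  let ?a = "prod_encode (1, 0)"
  have T: "Well_order ?T" using wo by (rule Well_order_seq_sum)
  have F: "Field ?T = {prod_encode (n, x) | n x. x \<in> Field (?s n)}"
    using wo by (rule Field_seq_sum)
  have a: "?a \<in> Field ?T"
    unfolding F by (rule CollectI, intro exI[of _ "1::nat"] exI[of _ "0::nat"]) (auto simp: Field_def)
  have wr: "Well_order (Restr ?T (underS ?T ?a))" by (rule Well_order_Restr[OF T])
  have "(r, Restr ?T (underS ?T ?a)) \<in> ordLeq"
  proof (rule strict_mono_imp_ordLeq[OF r wr, where f = "\<lambda>x. prod_encode (0, x)"])
    have *: "prod_encode (0, x) \<in> underS ?T ?a" if "x \<in> Field r" for x
      using that by (auto simp: underS_def seq_sum_iff prod_encode_eq Field_def)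
    show "prod_encode (0, x) \<in> Field (Restr ?T (underS ?T ?a))" if "x \<in> Field r" for x
      using *[OF that] by (subst Field_Restr_ofilter[OF T wo_rel.underS_ofilter]) (simp add: wo_rel_def T)
    show "(prod_encode (0, x), prod_encode (0, y)) \<in> Restr ?T (underS ?T ?a) \<and>
        prod_encode (0, x) \<noteq> prod_encode (0, y)" if "(x, y) \<in> r" "x \<noteq> y" for x y
    proof -
      have "x \<in> Field r" "y \<in> Field r" using that by (auto simp: Field_def)
      then show ?thesis using that * by (auto simp: seq_sum_iff prod_encode_eq)
    qed
  qed
  moreover have "(Restr ?T (underS ?T ?a), ?T) \<in> ordLess"
    using underS_Restr_ordLess[OF T] a by blast
  ultimately show ?thesis unfolding top_ext_def
    by (rule ordLeq_ordLess_trans)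
qed

subsection \<open>Countable ordinals\<close>

text \<open>
  Ordinals are order types of well-orderings of sets of natural numbers, that is, the countable
  ordinals. This is no restriction here: dialogue trees are countably branching and ordinal
  arithmetic and countable suprema stay within the countable ordinals
  (\<open>countable_imp_bdd_above\<close>, \<open>countable_lessThan_ordinal\<close>).
\<close>

quotient_type ordinal = "nat rel" / partial: "\<lambda>r s. (r, s) \<in> ordIso"
proof (rule part_equivpI)
  show "\<exists>r :: nat rel. (r, r) \<in> ordIso"
    using Well_order_small ordIso_reflexive by blast
qed (auto intro: sympI transpI ordIso_symmetric ordIso_transitive)

lemma Well_order_ordIso: "(r, s) \<in> ordIso \<Longrightarrow> Well_order r \<and> Well_order s"
  by (auto simp: ordIso_def)

lemma ordIso_self_iff: "(r, r) \<in> ordIso \<longleftrightarrow> Well_order r"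
  using Well_order_ordIso ordIso_reflexive by blast

lemma Well_order_rep: "Well_order (rep_ordinal a)"
  using Quotient3_rep_reflp[OF Quotient3_ordinal] ordIso_self_iff by blast

lemma rep_abs_ordinal: "Well_order r \<Longrightarrow> (rep_ordinal (abs_ordinal r), r) \<in> ordIso"
  by (simp add: rep_abs_rsp_left[OF Quotient3_ordinal] ordIso_self_iff ordIso_reflexive
      Quotient3_rep_abs[OF Quotient3_ordinal])

lemma ordinal_eq_iff: "a = b \<longleftrightarrow> (rep_ordinal a, rep_ordinal b) \<in> ordIso"
  using Quotient3_rel_rep[OF Quotient3_ordinal] by blast

instantiation ordinal :: wellorder
begin

definition less_eq_ordinal :: "ordinal \<Rightarrow> ordinal \<Rightarrow> bool" where
  "a \<le> b \<longleftrightarrow> (rep_ordinal a, rep_ordinal b) \<in> ordLeq"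

definition less_ordinal :: "ordinal \<Rightarrow> ordinal \<Rightarrow> bool" where
  "a < b \<longleftrightarrow> (rep_ordinal a, rep_ordinal b) \<in> ordLess"

instance
proof
  fix a b c :: ordinal
  show "a < b \<longleftrightarrow> a \<le> b \<and> \<not> b \<le> a"
    unfolding less_eq_ordinal_def less_ordinal_def
    using not_ordLeq_iff_ordLess[OF Well_order_rep Well_order_rep] ordLess_imp_ordLeq by blast
  show "a \<le> a"
    unfolding less_eq_ordinal_def using ordLeq_reflexive[OF Well_order_rep] .
  show "a \<le> b \<Longrightarrow> b \<le> c \<Longrightarrow> a \<le> c"
    unfolding less_eq_ordinal_def by (rule ordLeq_transitive)
  show "a \<le> b \<Longrightarrow> b \<le> a \<Longrightarrow> a = b"
    unfolding less_eq_ordinal_def by (simp add: ordinal_eq_iff ordIso_iff_ordLeq)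
  show "a \<le> b \<or> b \<le> a"
    unfolding less_eq_ordinal_def using ordLeq_total[OF Well_order_rep Well_order_rep] .
next
  fix P :: "ordinal \<Rightarrow> bool" and a
  assume step: "\<And>x. (\<And>y. y < x \<Longrightarrow> P y) \<Longrightarrow> P x"
  have "wf (inv_image ordLess rep_ordinal)" using wf_ordLess by (rule wf_inv_image)
  then show "P a"
  proof (induction a rule: wf_induct_rule)
    case (less x)
    show ?case by (rule step) (simp add: less less_ordinal_def)
  qed
qed

end

lemma ordinal_ex_greater: "\<exists>b. (a :: ordinal) < b"
proof
  let ?r = "top_ext (rep_ordinal a)"
  have "(rep_ordinal a, ?r) \<in> ordLess" using Well_order_rep by (rule ordLess_top_ext)
  moreover from this have "(?r, rep_ordinal (abs_ordinal ?r)) \<in> ordIso"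
    by (intro ordIso_symmetric[OF rep_abs_ordinal]) (auto simp: ordLess_def)
  ultimately show "a < abs_ordinal ?r"
    unfolding less_ordinal_def by (rule ordLess_ordIso_trans)
qed

lemma countable_imp_bdd_above:
  fixes A :: "ordinal set"
  assumes "countable A"
  shows "bdd_above A"
proof (cases "A = {}")
  case False
  let ?r = "\<lambda>n. rep_ordinal (from_nat_into A n)"
  have *: "(?r n, rep_ordinal (abs_ordinal (seq_sum ?r))) \<in> ordLeq" for n
    by (rule ordLeq_ordIso_trans[OF ordLeq_seq_sum ordIso_symmetric[OF rep_abs_ordinal]])
       (simp_all add: Well_order_rep Well_order_seq_sum)
  have "a \<le> abs_ordinal (seq_sum ?r)" if "a \<in> A" for a
    using * from_nat_into_surj[OF assms that] unfolding less_eq_ordinal_def by metis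
  then show ?thesis by (rule bdd_aboveI)
qed simp

lemma countable_lessThan_ordinal: "countable {..<a :: ordinal}"
proof (rule countable_subset)
  let ?r = "rep_ordinal a"
  show "{..<a} \<subseteq> range (\<lambda>x. abs_ordinal (Restr ?r (underS ?r x)))"
  proof
    fix b assume "b \<in> {..<a}"
    then have "(rep_ordinal b, ?r) \<in> ordLess" by (simp add: less_ordinal_def)
    then obtain x where x: "(rep_ordinal b, Restr ?r (underS ?r x)) \<in> ordIso"
      using ordLess_iff_ordIso_Restr[OF Well_order_rep Well_order_rep] by blast
    have "abs_ordinal (rep_ordinal b) = abs_ordinal (Restr ?r (underS ?r x))"
      using x Quotient3_rel[OF Quotient3_ordinal] ordIso_self_iff Well_order_ordIso by blast
    then show "b \<in> range (\<lambda>x. abs_ordinal (Restr ?r (underS ?r x)))"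
      by (simp add: Quotient3_abs_rep[OF Quotient3_ordinal])
  qed
qed simp

instantiation ordinal :: "{order_bot, conditionally_complete_linorder}"
begin

definition bot_ordinal :: ordinal where "bot_ordinal = (LEAST a. True)"
definition inf_ordinal :: "ordinal \<Rightarrow> ordinal \<Rightarrow> ordinal" where "inf_ordinal = min"
definition sup_ordinal :: "ordinal \<Rightarrow> ordinal \<Rightarrow> ordinal" where "sup_ordinal = max"
definition Inf_ordinal :: "ordinal set \<Rightarrow> ordinal" where "Inf_ordinal A = (LEAST a. a \<in> A)"
definition Sup_ordinal :: "ordinal set \<Rightarrow> ordinal" where "Sup_ordinal A = (LEAST b. \<forall>a\<in>A. a \<le> b)"

instance
proof
  fix a x z :: ordinal and A :: "ordinal set"
  show "bot \<le> a" by (simp add: bot_ordinal_def Least_le)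
  show "Inf A \<le> x" if "x \<in> A"
    using that by (simp add: Inf_ordinal_def Least_le)
  show "z \<le> Inf A" if "A \<noteq> {}" "\<And>x. x \<in> A \<Longrightarrow> z \<le> x"
  proof -
    have "Inf A \<in> A" unfolding Inf_ordinal_def
      by (rule LeastI_ex) (use that(1) in blast)
    then show ?thesis using that(2) by blast
  qed
  show "x \<le> Sup A" if "x \<in> A" "bdd_above A"
  proof -
    from that(2) have "\<exists>b. \<forall>a\<in>A. a \<le> b" by (simp add: bdd_above_def)
    then have "\<forall>a\<in>A. a \<le> Sup A" unfolding Sup_ordinal_def by (rule LeastI_ex)
    with that(1) show ?thesis by blast
  qed
  show "Sup A \<le> z" if "A \<noteq> {}" "\<And>x. x \<in> A \<Longrightarrow> x \<le> z"
    unfolding Sup_ordinal_def by (rule Least_le) (use that(2) in blast)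
qed (simp_all add: inf_ordinal_def sup_ordinal_def)

end

subsection \<open>Ordinal arithmetic\<close>

text \<open>
  Addition, multiplication and exponentiation are defined by uniform transfinite recursion; the
  usual zero, successor and limit clauses are derived below (\<open>plus_ordinal_osucc\<close>,
  \<open>plus_ordinal_limit\<close>, \<open>times_ordinal_zero\<close>, \<open>times_ordinal_osucc\<close>, \<open>times_ordinal_limit\<close>,
  \<open>opow_zero\<close>, \<open>opow_osucc\<close>, \<open>opow_limit\<close>).
\<close>

instantiation ordinal :: "{zero, one}"
begin

definition zero_ordinal :: ordinal where "0 = (bot :: ordinal)"
definition one_ordinal :: ordinal where "1 = (LEAST a :: ordinal. 0 < a)"
instance ..

end

definition osucc :: "ordinal \<Rightarrow> ordinal" where
  "osucc a = (LEAST b. a < b)"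

lemma zero_le_ordinal [simp]: "0 \<le> (a :: ordinal)"
  by (simp add: zero_ordinal_def)

lemma not_less_zero_ordinal [simp]: "\<not> a < (0 :: ordinal)"
  by (simp add: not_less)

lemma less_osucc [simp]: "a < osucc a"
  unfolding osucc_def using ordinal_ex_greater by (rule LeastI_ex)

lemma osucc_le_iff: "osucc a \<le> b \<longleftrightarrow> a < b"
proof
  show "osucc a \<le> b \<Longrightarrow> a < b" using less_osucc by (rule less_le_trans)
  show "a < b \<Longrightarrow> osucc a \<le> b" unfolding osucc_def by (rule Least_le)
qed

lemma less_osucc_iff: "a < osucc b \<longleftrightarrow> a \<le> b"
  using osucc_le_iff[of b a] by (metis linorder_not_le)

lemma one_ordinal_eq: "1 = osucc 0"
  by (simp add: one_ordinal_def osucc_def)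

lemma countable_cSup_le_iff:
  fixes A :: "ordinal set"
  assumes "countable A"
  shows "Sup A \<le> b \<longleftrightarrow> (\<forall>a\<in>A. a \<le> b)"
proof
  show "\<forall>a\<in>A. a \<le> b" if "Sup A \<le> b"
    by (intro ballI order_trans[OF cSup_upper that] countable_imp_bdd_above assms)
  show "Sup A \<le> b" if "\<forall>a\<in>A. a \<le> b"
    unfolding Sup_ordinal_def using that by (rule Least_le)
qed

instantiation ordinal :: plus
begin

function plus_ordinal :: "ordinal \<Rightarrow> ordinal \<Rightarrow> ordinal" where
  "plus_ordinal a b = Sup (insert a ((\<lambda>c. osucc (plus_ordinal a c)) ` {..<b}))"
  by auto
termination
  by (relation "inv_image {(x, y). x < y} snd") (rule wf_inv_image, rule wf, simp)

instance ..

end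

declare plus_ordinal.simps [simp del]

instantiation ordinal :: times
begin

function times_ordinal :: "ordinal \<Rightarrow> ordinal \<Rightarrow> ordinal" where
  "times_ordinal a b = Sup ((\<lambda>c. times_ordinal a c + a) ` {..<b})"
  by auto
termination
  by (relation "inv_image {(x, y). x < y} snd") (rule wf_inv_image, rule wf, simp)

instance ..

end

declare times_ordinal.simps [simp del]


lemma plus_ordinal_le_iff: "a + b \<le> x \<longleftrightarrow> a \<le> x \<and> (\<forall>c<b. a + c < x)" for a b x :: ordinal
  by (subst plus_ordinal.simps)
     (auto simp: countable_cSup_le_iff countable_lessThan_ordinal osucc_le_iff)

lemma less_plus_ordinal_iff: "x < a + b \<longleftrightarrow> x < a \<or> (\<exists>c<b. x \<le> a + c)" for a b x :: ordinal
  using plus_ordinal_le_iff[of a b x] by (auto simp: not_le[symmetric])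

lemma le_plus_ordinal: "a \<le> a + b" for a b :: ordinal
  using plus_ordinal_le_iff[of a b "a + b"] by simp

lemma plus_ordinal_strict_mono: "c < b \<Longrightarrow> a + c < a + b" for a b c :: ordinal
  using plus_ordinal_le_iff[of a b "a + b"] by simp

lemma plus_ordinal_mono_right: "c \<le> b \<Longrightarrow> a + c \<le> a + b" for a b c :: ordinal
  by (metis order_le_less plus_ordinal_strict_mono)

lemma plus_ordinal_mono: "a \<le> a' \<Longrightarrow> a + b \<le> a' + b" for a a' b :: ordinal
proof (induction b rule: less_induct)
  case (less b)
  have "a \<le> a' + b" using less.prems le_plus_ordinal by (rule order_trans)
  moreover have "a + c < a' + b" if "c < b" for c
    using less.IH[OF that less.prems] plus_ordinal_strict_mono[OF that] by (rule le_less_trans)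
  ultimately show ?case by (simp add: plus_ordinal_le_iff)
qed

lemma ordinal_eqI: "(\<And>x. a \<le> x \<longleftrightarrow> b \<le> x) \<Longrightarrow> a = b" for a b :: ordinal
  by (metis order_antisym order_refl)

instance ordinal :: monoid_add
proof
  fix a b c :: ordinal
  show "a + b + c = a + (b + c)"
  proof (induction c rule: less_induct)
    case (less c)
    show ?case
    proof (rule ordinal_eqI)
      fix x
      have "a + b + c \<le> x \<longleftrightarrow> a + b \<le> x \<and> (\<forall>d<c. a + (b + d) < x)"
        by (simp add: plus_ordinal_le_iff[of "a + b" c] less)
      also have "\<dots> \<longleftrightarrow> a \<le> x \<and> (\<forall>e<b. a + e < x) \<and> (\<forall>d<c. a + (b + d) < x)"
        by (simp add: plus_ordinal_le_iff[of a b] conj_assoc)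
      also have "\<dots> \<longleftrightarrow> a \<le> x \<and> (\<forall>e<b + c. a + e < x)"
      proof -
        have "a + e < x" if "e \<le> b + d" "a + (b + d) < x" for e d
          using plus_ordinal_mono_right[OF that(1)] that(2) by (rule le_less_trans)
        then show ?thesis
          by (auto simp: less_plus_ordinal_iff[of _ b c] intro: plus_ordinal_strict_mono)
      qed
      also have "\<dots> \<longleftrightarrow> a + (b + c) \<le> x"
        by (simp add: plus_ordinal_le_iff[of a "b + c"])
      finally show "a + b + c \<le> x \<longleftrightarrow> a + (b + c) \<le> x" .
    qed
  qed
  show "a + 0 = a" by (rule ordinal_eqI) (simp add: plus_ordinal_le_iff)
  show "0 + a = a"
  proof (induction a rule: less_induct)
    case (less a)
    show ?case
    proof (rule antisym)
      show "0 + a \<le> a" by (simp add: plus_ordinal_le_iff less)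
      show "a \<le> 0 + a"
        by (rule ccontr) (use less[of "0 + a"] plus_ordinal_strict_mono[of "0 + a" a 0] in \<open>simp add: not_le\<close>)
    qed
  qed
qed

instance ordinal :: numeral ..

lemma plus_ordinal_osucc: "a + osucc b = osucc (a + b)"
proof (rule ordinal_eqI)
  fix x
  have "a + c < x" if "a + b < x" "c \<le> b" for c
    using plus_ordinal_mono_right[OF that(2)] that(1) by (rule le_less_trans)
  moreover have "a \<le> x" if "a + b < x"
    using le_plus_ordinal[of a b] that by simp
  ultimately show "a + osucc b \<le> x \<longleftrightarrow> osucc (a + b) \<le> x"
    by (auto simp: plus_ordinal_le_iff less_osucc_iff osucc_le_iff)
qed

lemma plus_one_ordinal: "a + 1 = osucc a"
  by (simp add: one_ordinal_eq plus_ordinal_osucc)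

lemma times_ordinal_le_iff: "a * b \<le> x \<longleftrightarrow> (\<forall>c<b. a * c + a \<le> x)" for a b x :: ordinal
  by (subst times_ordinal.simps)
     (auto simp: countable_cSup_le_iff countable_lessThan_ordinal)

lemma times_ordinal_mono_right: "b \<le> b' \<Longrightarrow> a * b \<le> a * b'" for a b b' :: ordinal
  using times_ordinal_le_iff[of a b' "a * b'"] by (auto simp: times_ordinal_le_iff[of a b])

lemma times_ordinal_mono_left: "a \<le> a' \<Longrightarrow> a * b \<le> a' * b" for a a' b :: ordinal
proof (induction b rule: less_induct)
  case (less b)
  have "a * c + a \<le> a' * b" if "c < b" for c
  proof -
    have "a * c + a \<le> a' * c + a" using less that by (intro plus_ordinal_mono)
    also have "\<dots> \<le> a' * c + a'"
      using less.prems by (rule plus_ordinal_mono_right)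
    also have "\<dots> \<le> a' * b" using that times_ordinal_le_iff[of a' b "a' * b"] by simp
    finally show ?thesis .
  qed
  then show ?case by (simp add: times_ordinal_le_iff[of a b])
qed

lemma times_ordinal_zero: "a * 0 = (0 :: ordinal)"
  by (rule antisym) (simp_all add: times_ordinal_le_iff)

lemma times_ordinal_osucc: "a * osucc b = a * b + a"
proof (rule antisym)
  have "a * c + a \<le> a * b + a" if "c \<le> b" for c
    using that by (intro plus_ordinal_mono times_ordinal_mono_right)
  then show "a * osucc b \<le> a * b + a"
    by (simp add: times_ordinal_le_iff[of a "osucc b"] less_osucc_iff)
  show "a * b + a \<le> a * osucc b"
    using times_ordinal_le_iff[of a "osucc b" "a * osucc b"] by simp
qed

function opow :: "ordinal \<Rightarrow> ordinal \<Rightarrow> ordinal"  (infixr \<open>\<up>\<close> 80) where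
  "a \<up> b = (if a = 0 then (if b = 0 then 1 else 0)
            else Sup (insert 1 ((\<lambda>c. a \<up> c * a) ` {..<b})))"
  by auto
termination
  by (relation "inv_image {(x, y). x < y} snd") (rule wf_inv_image, rule wf, simp)

declare opow.simps [simp del]

lemma opow_le_iff: "a \<noteq> 0 \<Longrightarrow> a \<up> b \<le> x \<longleftrightarrow> 1 \<le> x \<and> (\<forall>c<b. a \<up> c * a \<le> x)"
  by (subst opow.simps)
     (auto simp: countable_cSup_le_iff countable_lessThan_ordinal)

lemma opow_mono: "a \<noteq> 0 \<Longrightarrow> b \<le> b' \<Longrightarrow> a \<up> b \<le> a \<up> b'"
  using opow_le_iff[of a b' "a \<up> b'"] by (auto simp: opow_le_iff[of a b])

lemma opow_zero: "a \<up> 0 = 1"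
proof (cases "a = 0")
  case False
  then show ?thesis by (intro ordinal_eqI) (simp add: opow_le_iff)
qed (simp add: opow.simps)

lemma opow_osucc: "a \<up> osucc b = a \<up> b * a"
proof (cases "a = 0")
  case True
  moreover have "osucc b \<noteq> 0" by (metis less_osucc not_less_zero_ordinal)
  ultimately show ?thesis by (simp add: opow.simps[of 0 "osucc b"] times_ordinal_zero)
next
  case False
  show ?thesis
  proof (rule antisym)
    have "a \<up> c * a \<le> a \<up> b * a" if "c \<le> b" for c
      using that False by (intro times_ordinal_mono_left opow_mono)
    moreover have "1 \<le> a \<up> b * a"
    proof -
      have "0 < a" using False by (simp add: order_less_le)
      have "1 \<le> a \<up> b" using opow_le_iff[OF False, of b "a \<up> b"] by simp
      also have "\<dots> = 0 + a \<up> b" by simp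
      also have "\<dots> = a \<up> b * 0 + a \<up> b" by (simp add: times_ordinal_zero)
      also have "\<dots> \<le> a \<up> b * a" using \<open>0 < a\<close> times_ordinal_le_iff[of "a \<up> b" a "a \<up> b * a"] by simp
      finally show ?thesis .
    qed
    ultimately show "a \<up> osucc b \<le> a \<up> b * a"
      using False by (simp add: opow_le_iff[of a "osucc b"] less_osucc_iff)
    show "a \<up> b * a \<le> a \<up> osucc b"
      using opow_le_iff[OF False, of "osucc b" "a \<up> osucc b"] by simp
  qed
qed

definition limit_ordinal :: "ordinal \<Rightarrow> bool" where
  "limit_ordinal b \<longleftrightarrow> b \<noteq> 0 \<and> (\<forall>c<b. osucc c < b)"

lemma limit_ordinal_Sup:
  fixes f :: "ordinal \<Rightarrow> ordinal"
  assumes b: "limit_ordinal b" and mono: "\<And>c d. c \<le> d \<Longrightarrow> f c \<le> f d"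
    and le_iff: "\<And>x. f b \<le> x \<longleftrightarrow> p \<le> x \<and> (\<forall>c<b. f (osucc c) \<le> x)" and p: "p \<le> f 0"
  shows "f b = Sup (f ` {..<b})"
proof (rule ordinal_eqI)
  fix x
  have "0 < b" using b by (simp add: limit_ordinal_def order_less_le)
  have "f b \<le> x \<longleftrightarrow> (\<forall>c<b. f c \<le> x)"
  proof
    assume "f b \<le> x"
    show "\<forall>c<b. f c \<le> x"
    proof (intro allI impI)
      fix c assume "c < b"
      then have "f c \<le> f b" by (intro mono) simp
      with \<open>f b \<le> x\<close> show "f c \<le> x" by simp
    qed
  next
    assume "\<forall>c<b. f c \<le> x"
    then show "f b \<le> x"
      using b \<open>0 < b\<close> p order_trans by (simp add: le_iff limit_ordinal_def) blast
  qed
  then show "f b \<le> x \<longleftrightarrow> Sup (f ` {..<b}) \<le> x"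
    by (auto simp: countable_cSup_le_iff countable_lessThan_ordinal)
qed

lemma plus_ordinal_limit:
  assumes "limit_ordinal b"
  shows "a + b = Sup ((+) a ` {..<b})"
proof (rule limit_ordinal_Sup[OF assms, where p = a])
  show "a + c \<le> a + d" if "c \<le> d" for c d
    using that by (rule plus_ordinal_mono_right)
qed (simp_all add: plus_ordinal_le_iff[of a b] plus_ordinal_osucc osucc_le_iff)

lemma times_ordinal_limit:
  assumes "limit_ordinal b"
  shows "a * b = Sup ((*) a ` {..<b})"
  by (rule limit_ordinal_Sup[OF assms, where p = 0])
     (simp_all add: times_ordinal_mono_right times_ordinal_le_iff[of a b] times_ordinal_osucc)

lemma opow_limit:
  assumes "limit_ordinal b" "a \<noteq> 0"
  shows "a \<up> b = Sup ((\<up>) a ` {..<b})"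
  by (rule limit_ordinal_Sup[OF assms(1), where p = 1])
     (simp_all add: assms(2) opow_mono opow_le_iff[of a b] opow_osucc opow_zero)

primrec ord_of_nat :: "nat \<Rightarrow> ordinal" where
  "ord_of_nat 0 = 0"
| "ord_of_nat (Suc n) = ord_of_nat n + 1"

definition omega :: ordinal (\<open>\<omega>\<close>) where
  "\<omega> = (SUP n. ord_of_nat n)"

primrec E2 :: "nat \<Rightarrow> ordinal \<Rightarrow> ordinal" where
  "E2 0 a = a"
| "E2 (Suc n) a = 2 \<up> E2 n a"

section \<open>System T and its dialogue interpretation\<close>

subsection \<open>System T\<close>

datatype ty = Iota (\<open>\<iota>\<close>) | Fun ty ty  (infixr \<open>\<rightarrowtriangle>\<close> 65)

primrec lev :: "ty \<Rightarrow> nat" where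
  "lev \<iota> = 0"
| "lev (\<sigma> \<rightarrowtriangle> \<tau>) = max (lev \<sigma> + 1) (lev \<tau>)"

text \<open>\<open>arity \<sigma>\<close> is the number \<open>k\<close> with \<open>\<sigma> = \<sigma>\<^sub>1 \<rightarrow> \<dots> \<rightarrow> \<sigma>\<^sub>k \<rightarrow> \<iota>\<close>.\<close>

primrec arity :: "ty \<Rightarrow> nat" where
  "arity \<iota> = 0"
| "arity (\<sigma> \<rightarrowtriangle> \<tau>) = Suc (arity \<tau>)"

primrec subtypes :: "ty \<Rightarrow> ty set" where
  "subtypes \<iota> = {\<iota>}"
| "subtypes (\<sigma> \<rightarrowtriangle> \<tau>) = insert (\<sigma> \<rightarrowtriangle> \<tau>) (subtypes \<sigma> \<union> subtypes \<tau>)"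

text \<open>
  Terms are in de Bruijn notation, so equality is equality up to renaming of bound
  variables; a context is a list of types, \<open>Var i\<close> having the type at position \<open>i\<close>.
  Terms are polymorphic in their constants: \<open>const tm\<close> is System T and \<open>xconst tm\<close> is
  the extended source language.
\<close>

datatype 'c tm = Var nat | Lam ty "'c tm" | App "'c tm" "'c tm" | Const 'c

datatype const = Zero | Succ | Rec ty

datatype xconst = Src const | Omega

primrec const_ty :: "const \<Rightarrow> ty" where
  "const_ty Zero = \<iota>"
| "const_ty Succ = \<iota> \<rightarrowtriangle> \<iota>"
| "const_ty (Rec \<sigma>) = (\<iota> \<rightarrowtriangle> \<sigma> \<rightarrowtriangle> \<sigma>) \<rightarrowtriangle> \<sigma> \<rightarrowtriangle> \<iota> \<rightarrowtriangle> \<sigma>"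

primrec xconst_ty :: "xconst \<Rightarrow> ty" where
  "xconst_ty (Src c) = const_ty c"
| "xconst_ty Omega = \<iota> \<rightarrowtriangle> \<iota>"

inductive has_type :: "('c \<Rightarrow> ty) \<Rightarrow> ty list \<Rightarrow> 'c tm \<Rightarrow> ty \<Rightarrow> bool" for cty where
  Var: "i < length \<Gamma> \<Longrightarrow> has_type cty \<Gamma> (Var i) (\<Gamma> ! i)"
| Lam: "has_type cty (\<sigma> # \<Gamma>) u \<tau> \<Longrightarrow> has_type cty \<Gamma> (Lam \<sigma> u) (\<sigma> \<rightarrowtriangle> \<tau>)"
| App: "has_type cty \<Gamma> u (\<sigma> \<rightarrowtriangle> \<tau>) \<Longrightarrow> has_type cty \<Gamma> v \<sigma> \<Longrightarrow> has_type cty \<Gamma> (App u v) \<tau>"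
| Const: "has_type cty \<Gamma> (Const c) (cty c)"

text \<open>The type of a typable term (a junk value on ill-typed terms).\<close>

primrec type_of :: "('c \<Rightarrow> ty) \<Rightarrow> ty list \<Rightarrow> 'c tm \<Rightarrow> ty" where
  "type_of cty \<Gamma> (Var i) = \<Gamma> ! i"
| "type_of cty \<Gamma> (Lam \<sigma> u) = \<sigma> \<rightarrowtriangle> type_of cty (\<sigma> # \<Gamma>) u"
| "type_of cty \<Gamma> (App u v) = (case type_of cty \<Gamma> u of \<sigma> \<rightarrowtriangle> \<tau> \<Rightarrow> \<tau> | \<iota> \<Rightarrow> \<iota>)"
| "type_of cty \<Gamma> (Const c) = cty c"

lemma has_type_type_of: "has_type cty \<Gamma> t \<tau> \<Longrightarrow> type_of cty \<Gamma> t = \<tau>"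
  by (induction rule: has_type.induct) simp_all

subsection \<open>Source ceiling and source offset\<close>

primrec const_ceiling :: "const \<Rightarrow> nat" where
  "const_ceiling Zero = 0"
| "const_ceiling Succ = 1"
| "const_ceiling (Rec \<sigma>) = lev ((\<iota> \<rightarrowtriangle> \<sigma> \<rightarrowtriangle> \<sigma>) \<rightarrowtriangle> \<sigma> \<rightarrowtriangle> \<iota> \<rightarrowtriangle> \<sigma>)"

primrec xconst_ceiling :: "xconst \<Rightarrow> nat" where
  "xconst_ceiling (Src c) = const_ceiling c"
| "xconst_ceiling Omega = 1"

primrec src_ceiling :: "ty list \<Rightarrow> xconst tm \<Rightarrow> nat" where
  "src_ceiling \<Gamma> (Var i) = lev (\<Gamma> ! i)"
| "src_ceiling \<Gamma> (Lam \<sigma> u) =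
     max (lev (\<sigma> \<rightarrowtriangle> type_of xconst_ty (\<sigma> # \<Gamma>) u)) (src_ceiling (\<sigma> # \<Gamma>) u)"
| "src_ceiling \<Gamma> (App u v) =
     Max {lev (type_of xconst_ty \<Gamma> (App u v)), src_ceiling \<Gamma> u, src_ceiling \<Gamma> v}"
| "src_ceiling \<Gamma> (Const c) = xconst_ceiling c"

primrec const_offset :: "const \<Rightarrow> nat" where
  "const_offset Zero = 0"
| "const_offset Succ = 2"
| "const_offset (Rec \<sigma>) = 2 * arity \<sigma> + 4"

primrec xconst_offset :: "xconst \<Rightarrow> nat" where
  "xconst_offset (Src c) = const_offset c"
| "xconst_offset Omega = 3"

primrec src_offset :: "xconst tm \<Rightarrow> nat" where
  "src_offset (Var i) = 0"
| "src_offset (Lam \<sigma> u) = src_offset u + 1"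
| "src_offset (App u v) = max (src_offset u) (src_offset v) + 1"
| "src_offset (Const c) = xconst_offset c"

definition app_Omega :: "const tm \<Rightarrow> xconst tm" where
  "app_Omega t = App (map_tm Src t) (Const Omega)"

definition K_of :: "const tm \<Rightarrow> nat" where
  "K_of t = src_ceiling [] (app_Omega t)"

definition m_of :: "const tm \<Rightarrow> nat" where
  "m_of t = src_offset (app_Omega t)"

subsection \<open>Dialogue trees\<close>

datatype 'x dialogue = Eta 'x | Beta nat "nat \<Rightarrow> 'x dialogue"

primrec height :: "nat dialogue \<Rightarrow> ordinal" where
  "height (Eta n) = 0"
| "height (Beta i \<phi>) = (SUP n. height (\<phi> n) + 1)"

primrec graft :: "'x dialogue \<Rightarrow> ('x \<Rightarrow> 'y dialogue) \<Rightarrow> 'y dialogue" where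
  "graft (Eta x) g = g x"
| "graft (Beta i \<phi>) g = Beta i (\<lambda>n. graft (\<phi> n) g)"

definition dmap :: "('x \<Rightarrow> 'y) \<Rightarrow> 'x dialogue \<Rightarrow> 'y dialogue" where
  "dmap f d = graft d (\<lambda>x. Eta (f x))"

definition gen :: "nat dialogue \<Rightarrow> nat dialogue" where
  "gen d = graft d (\<lambda>i. Beta i (\<lambda>n. Eta n))"

subsection \<open>The dialogue interpretation\<close>

text \<open>
  The sets \<open>V\<^sub>\<iota> = \<D>(\<nat>)\<close>, \<open>V\<^bsub>\<sigma>\<rightarrow>\<tau>\<^esub> = V\<^sub>\<sigma> \<rightarrow> V\<^sub>\<tau>\<close> have unboundedly growing (iterated power set)
  cardinalities, so no type that HOL can construct contains all of them. They are therefore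
  represented inside an arbitrary type \<open>'v\<close>: \<open>car M \<sigma>\<close> is the copy of \<open>V\<^sub>\<sigma>\<close>, \<open>leaf M\<close>
  identifies dialogue trees with \<open>V\<^sub>\<iota>\<close>, and \<open>ap M\<close> identifies the elements of
  \<open>V\<^bsub>\<sigma>\<rightarrow>\<tau>\<^esub>\<close> with all functions from \<open>V\<^sub>\<sigma>\<close> to \<open>V\<^sub>\<tau>\<close>. The predicate \<open>full_on M S\<close> requires
  this for all types in \<open>S\<close> and their components. A term only involves the finitely many
  types in \<open>types_in\<close>, for which a suitable \<open>'v\<close> is obtained by iterating \<open>full_on_step\<close>
  from \<open>full_on_base\<close>, and the dialogue tree of the term does not depend on the choice of
  \<open>'v\<close> and \<open>M\<close> (\<open>D_of_unique\<close>).
\<close>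

record 'v type_structure =
  car :: "ty \<Rightarrow> 'v set"
  leaf :: "nat dialogue \<Rightarrow> 'v"
  ap :: "'v \<Rightarrow> 'v \<Rightarrow> 'v"

definition full_on :: "'v type_structure \<Rightarrow> ty set \<Rightarrow> bool" where
  "full_on M S \<longleftrightarrow>
     bij_betw (leaf M) UNIV (car M \<iota>) \<and>
     (\<forall>\<sigma> \<tau>. \<sigma> \<rightarrowtriangle> \<tau> \<in> \<Union> (subtypes ` S) \<longrightarrow>
        bij_betw (\<lambda>f. restrict (ap M f) (car M \<sigma>)) (car M (\<sigma> \<rightarrowtriangle> \<tau>)) (car M \<sigma> \<rightarrow>\<^sub>E car M \<tau>))"

primrec types_in :: "ty list \<Rightarrow> const tm \<Rightarrow> ty set" where
  "types_in \<Gamma> (Var i) = {\<Gamma> ! i}"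
| "types_in \<Gamma> (Lam \<sigma> u) = insert (type_of const_ty \<Gamma> (Lam \<sigma> u)) (types_in (\<sigma> # \<Gamma>) u)"
| "types_in \<Gamma> (App u v) =
     insert (type_of const_ty \<Gamma> (App u v)) (types_in \<Gamma> u \<union> types_in \<Gamma> v)"
| "types_in \<Gamma> (Const c) = {const_ty c}"

definition unleaf :: "'v type_structure \<Rightarrow> 'v \<Rightarrow> nat dialogue" where
  "unleaf M = inv (leaf M)"

text \<open>\<open>vabs M \<sigma> \<tau> F\<close> is the element of \<open>V\<^bsub>\<sigma>\<rightarrow>\<tau>\<^esub>\<close> that represents the function \<open>F\<close>.\<close>

definition vabs :: "'v type_structure \<Rightarrow> ty \<Rightarrow> ty \<Rightarrow> ('v \<Rightarrow> 'v) \<Rightarrow> 'v" where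
  "vabs M \<sigma> \<tau> F =
     inv_into (car M (\<sigma> \<rightarrowtriangle> \<tau>)) (\<lambda>f. restrict (ap M f) (car M \<sigma>)) (restrict F (car M \<sigma>))"

primrec tgraft :: "'v type_structure \<Rightarrow> ty \<Rightarrow> 'x dialogue \<Rightarrow> ('x \<Rightarrow> 'v) \<Rightarrow> 'v" where
  "tgraft M \<iota> d g = leaf M (graft d (\<lambda>x. unleaf M (g x)))"
| "tgraft M (\<sigma> \<rightarrowtriangle> \<tau>) d g = vabs M \<sigma> \<tau> (\<lambda>a. tgraft M \<tau> d (\<lambda>x. ap M (g x) a))"

primrec const_sem :: "'v type_structure \<Rightarrow> const \<Rightarrow> 'v" where
  "const_sem M Zero = leaf M (Eta 0)"
| "const_sem M Succ = vabs M \<iota> \<iota> (\<lambda>d. leaf M (dmap (\<lambda>n. n + 1) (unleaf M d)))"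
| "const_sem M (Rec \<sigma>) =
     vabs M (\<iota> \<rightarrowtriangle> \<sigma> \<rightarrowtriangle> \<sigma>) (\<sigma> \<rightarrowtriangle> \<iota> \<rightarrowtriangle> \<sigma>) (\<lambda>f. vabs M \<sigma> (\<iota> \<rightarrowtriangle> \<sigma>) (\<lambda>a. vabs M \<iota> \<sigma> (\<lambda>d.
       tgraft M \<sigma> (unleaf M d) (rec_nat a (\<lambda>n v. ap M (ap M f (leaf M (Eta n))) v)))))"

primrec sem :: "'v type_structure \<Rightarrow> ty list \<Rightarrow> 'v list \<Rightarrow> const tm \<Rightarrow> 'v" where
  "sem M \<Gamma> \<gamma> (Var i) = \<gamma> ! i"
| "sem M \<Gamma> \<gamma> (Lam \<sigma> u) =
     vabs M \<sigma> (type_of const_ty (\<sigma> # \<Gamma>) u) (\<lambda>a. sem M (\<sigma> # \<Gamma>) (a # \<gamma>) u)"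
| "sem M \<Gamma> \<gamma> (App u v) = ap M (sem M \<Gamma> \<gamma> u) (sem M \<Gamma> \<gamma> v)"
| "sem M \<Gamma> \<gamma> (Const c) = const_sem M c"

definition D_of :: "'v type_structure \<Rightarrow> const tm \<Rightarrow> nat dialogue" where
  "D_of M t = unleaf M (ap M (sem M [] [] t) (vabs M \<iota> \<iota> (\<lambda>d. leaf M (gen (unleaf M d)))))"

paragraph \<open>The interpretation is well defined\<close>

lemma subtypes_refl: "\<sigma> \<in> subtypes \<sigma>"
  by (cases \<sigma>) simp_all

lemma subtypes_trans: "\<sigma> \<in> subtypes \<tau> \<Longrightarrow> \<tau> \<in> subtypes \<rho> \<Longrightarrow> \<sigma> \<in> subtypes \<rho>"
  by (induction \<rho>) auto

lemma subtypes_FunD: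
  shows "\<sigma> \<rightarrowtriangle> \<tau> \<in> subtypes \<rho> \<Longrightarrow> \<sigma> \<in> subtypes \<rho>"
    and "\<sigma> \<rightarrowtriangle> \<tau> \<in> subtypes \<rho> \<Longrightarrow> \<tau> \<in> subtypes \<rho>"
  by (auto intro: subtypes_trans[of _ "\<sigma> \<rightarrowtriangle> \<tau>"] simp: subtypes_refl)

lemma full_on_mono: "full_on M T \<Longrightarrow> S \<subseteq> T \<Longrightarrow> full_on M S"
  unfolding full_on_def by blast

lemma
  assumes "full_on M S"
  shows leaf_in: "leaf M d \<in> car M \<iota>"
    and unleaf_leaf: "unleaf M (leaf M d) = d"
    and leaf_unleaf: "a \<in> car M \<iota> \<Longrightarrow> leaf M (unleaf M a) = a"
  using assms by (auto simp: full_on_def unleaf_def bij_betw_def f_inv_into_f)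

lemma
  assumes M: "full_on M S" and \<sigma>\<tau>: "\<sigma> \<rightarrowtriangle> \<tau> \<in> \<Union> (subtypes ` S)"
    and F: "\<And>a. a \<in> car M \<sigma> \<Longrightarrow> F a \<in> car M \<tau>"
  shows vabs_in: "vabs M \<sigma> \<tau> F \<in> car M (\<sigma> \<rightarrowtriangle> \<tau>)"
    and ap_vabs: "a \<in> car M \<sigma> \<Longrightarrow> ap M (vabs M \<sigma> \<tau> F) a = F a"
proof -
  let ?r = "\<lambda>f. restrict (ap M f) (car M \<sigma>)"
  have "bij_betw ?r (car M (\<sigma> \<rightarrowtriangle> \<tau>)) (car M \<sigma> \<rightarrow>\<^sub>E car M \<tau>)"
    using M \<sigma>\<tau> by (simp add: full_on_def)
  then have "restrict F (car M \<sigma>) \<in> ?r ` car M (\<sigma> \<rightarrowtriangle> \<tau>)"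
    using F by (simp add: bij_betw_def)
  from inv_into_into[OF this] f_inv_into_f[OF this]
  show "vabs M \<sigma> \<tau> F \<in> car M (\<sigma> \<rightarrowtriangle> \<tau>)" "a \<in> car M \<sigma> \<Longrightarrow> ap M (vabs M \<sigma> \<tau> F) a = F a"
    by (auto simp: vabs_def dest: fun_cong[of _ _ a])
qed

lemma ap_in:
  assumes "full_on M S" "\<sigma> \<rightarrowtriangle> \<tau> \<in> \<Union> (subtypes ` S)" "f \<in> car M (\<sigma> \<rightarrowtriangle> \<tau>)" "a \<in> car M \<sigma>"
  shows "ap M f a \<in> car M \<tau>"
proof -
  have "restrict (ap M f) (car M \<sigma>) \<in> car M \<sigma> \<rightarrow>\<^sub>E car M \<tau>"
    using assms(1-3) unfolding full_on_def by (metis (no_types, lifting) bij_betw_apply)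
  then show ?thesis using assms(4) by (auto simp: PiE_def Pi_def)
qed

lemma tgraft_in:
  assumes M: "full_on M S"
  shows "\<sigma> \<in> \<Union> (subtypes ` S) \<Longrightarrow> (\<And>x. g x \<in> car M \<sigma>) \<Longrightarrow> tgraft M \<sigma> d g \<in> car M \<sigma>"
proof (induction \<sigma> arbitrary: g)
  case Iota
  show ?case using leaf_in[OF M] by simp
next
  case (Fun \<sigma> \<tau>)
  from Fun.prems(1) have "\<tau> \<in> \<Union> (subtypes ` S)" by (auto dest: subtypes_FunD)
  then show ?case
    using Fun.prems by (auto intro!: vabs_in[OF M] Fun.IH(2) ap_in[OF M])
qed

lemma const_sem_in:
  assumes M: "full_on M S" and c: "const_ty c \<in> \<Union> (subtypes ` S)"
  shows "const_sem M c \<in> car M (const_ty c)"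
proof (cases c)
  case Zero
  then show ?thesis using leaf_in[OF M] by simp
next
  case Succ
  then show ?thesis using c by (auto intro!: vabs_in[OF M] leaf_in[OF M])
next
  case (Rec \<sigma>)
  let ?U = "\<Union> (subtypes ` S)"
  have U: "(\<iota> \<rightarrowtriangle> \<sigma> \<rightarrowtriangle> \<sigma>) \<rightarrowtriangle> \<sigma> \<rightarrowtriangle> \<iota> \<rightarrowtriangle> \<sigma> \<in> ?U" "\<iota> \<rightarrowtriangle> \<sigma> \<rightarrowtriangle> \<sigma> \<in> ?U"
    "\<sigma> \<rightarrowtriangle> \<iota> \<rightarrowtriangle> \<sigma> \<in> ?U" "\<iota> \<rightarrowtriangle> \<sigma> \<in> ?U" "\<sigma> \<rightarrowtriangle> \<sigma> \<in> ?U" "\<sigma> \<in> ?U"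
    using c Rec by (auto dest: subtypes_FunD)
  have "rec_nat a (\<lambda>n v. ap M (ap M f (leaf M (Eta n))) v) n \<in> car M \<sigma>"
    if "f \<in> car M (\<iota> \<rightarrowtriangle> \<sigma> \<rightarrowtriangle> \<sigma>)" "a \<in> car M \<sigma>" for f a n
    by (induction n) (use that in \<open>auto intro!: ap_in[OF M U(5)] ap_in[OF M U(2)] leaf_in[OF M]\<close>)
  then show ?thesis
    using Rec U by (auto intro!: vabs_in[OF M] tgraft_in[OF M])
qed

lemma type_in_types_in: "type_of const_ty \<Gamma> t \<in> types_in \<Gamma> t"
  by (cases t) simp_all

lemma sem_in:
  assumes M: "full_on M S"
  shows "has_type const_ty \<Gamma> t \<tau> \<Longrightarrow> types_in \<Gamma> t \<subseteq> \<Union> (subtypes ` S) \<Longrightarrow>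
    length \<gamma> = length \<Gamma> \<Longrightarrow> (\<And>i. i < length \<Gamma> \<Longrightarrow> \<gamma> ! i \<in> car M (\<Gamma> ! i)) \<Longrightarrow>
    sem M \<Gamma> \<gamma> t \<in> car M \<tau>"
proof (induction arbitrary: \<gamma> rule: has_type.induct)
  case (Lam \<sigma> \<Gamma> u \<tau>)
  have "sem M (\<sigma> # \<Gamma>) (a # \<gamma>) u \<in> car M \<tau>" if "a \<in> car M \<sigma>" for a
    using Lam.prems that by (intro Lam.IH) (auto simp: nth_Cons split: nat.split)
  with Lam show ?case
    by (auto simp: has_type_type_of[OF Lam.hyps] intro!: vabs_in[OF M])
next
  case (App \<Gamma> u \<sigma> \<tau> v)
  have "\<sigma> \<rightarrowtriangle> \<tau> \<in> types_in \<Gamma> u"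
    using type_in_types_in[of \<Gamma> u] has_type_type_of[OF App.hyps(1)] by simp
  with App show ?case by (auto intro!: ap_in[OF M])
next
  case (Const \<Gamma> c)
  then show ?case using const_sem_in[OF M] by simp
qed simp

paragraph \<open>The dialogue tree does not depend on the representation\<close>

primrec trel :: "'v type_structure \<Rightarrow> 'w type_structure \<Rightarrow> ty \<Rightarrow> 'v \<Rightarrow> 'w \<Rightarrow> bool" where
  "trel M N \<iota> x y \<longleftrightarrow> (\<exists>d. x = leaf M d \<and> y = leaf N d)"
| "trel M N (\<sigma> \<rightarrowtriangle> \<tau>) f g \<longleftrightarrow> f \<in> car M (\<sigma> \<rightarrowtriangle> \<tau>) \<and> g \<in> car N (\<sigma> \<rightarrowtriangle> \<tau>) \<and>
     (\<forall>a b. trel M N \<sigma> a b \<longrightarrow> trel M N \<tau> (ap M f a) (ap N g b))"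

context
  fixes M :: "'v type_structure" and N :: "'w type_structure" and S :: "ty set"
  assumes M: "full_on M S" and N: "full_on N S"
begin

lemma trel_in: "trel M N \<sigma> x y \<Longrightarrow> x \<in> car M \<sigma> \<and> y \<in> car N \<sigma>"
  using leaf_in[OF M] leaf_in[OF N] by (cases \<sigma>) auto

lemma vabs_rel:
  assumes "\<sigma> \<rightarrowtriangle> \<tau> \<in> \<Union> (subtypes ` S)"
    and "\<And>a. a \<in> car M \<sigma> \<Longrightarrow> F a \<in> car M \<tau>" "\<And>b. b \<in> car N \<sigma> \<Longrightarrow> G b \<in> car N \<tau>"
    and "\<And>a b. trel M N \<sigma> a b \<Longrightarrow> trel M N \<tau> (F a) (G b)"
  shows "trel M N (\<sigma> \<rightarrowtriangle> \<tau>) (vabs M \<sigma> \<tau> F) (vabs N \<sigma> \<tau> G)"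
proof -
  have "trel M N \<tau> (ap M (vabs M \<sigma> \<tau> F) a) (ap N (vabs N \<sigma> \<tau> G) b)" if ab: "trel M N \<sigma> a b" for a b
    using trel_in[OF ab] assms(4)[OF ab]
    by (simp add: ap_vabs[where F = F, OF M assms(1,2)] ap_vabs[where F = G, OF N assms(1,3)])
  then show ?thesis
    using vabs_in[where F = F, OF M assms(1,2)] vabs_in[where F = G, OF N assms(1,3)] by simp
qed

lemma leaf_rel: "trel M N \<iota> (leaf M d) (leaf N d)"
  by auto

lemma tgraft_rel:
  "\<sigma> \<in> \<Union> (subtypes ` S) \<Longrightarrow> (\<And>x. trel M N \<sigma> (g x) (g' x)) \<Longrightarrow>
   trel M N \<sigma> (tgraft M \<sigma> d g) (tgraft N \<sigma> d g')"
proof (induction \<sigma> arbitrary: g g')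
  case Iota
  have "unleaf M (g x) = unleaf N (g' x)" for x
    using Iota.prems(2)[of x] unleaf_leaf[OF M] unleaf_leaf[OF N] by auto
  then show ?case unfolding tgraft.simps by (simp only: leaf_rel)
next
  case (Fun \<sigma> \<tau>)
  from Fun.prems(1) have \<tau>: "\<tau> \<in> \<Union> (subtypes ` S)" by (auto dest: subtypes_FunD)
  have g: "g x \<in> car M (\<sigma> \<rightarrowtriangle> \<tau>)" "g' x \<in> car N (\<sigma> \<rightarrowtriangle> \<tau>)" for x
    using trel_in[OF Fun.prems(2)] by auto
  show ?case
    unfolding tgraft.simps
  proof (rule vabs_rel[OF Fun.prems(1)])
    show "tgraft M \<tau> d (\<lambda>x. ap M (g x) a) \<in> car M \<tau>" if "a \<in> car M \<sigma>" for a
      using that by (intro tgraft_in[OF M \<tau>] ap_in[OF M Fun.prems(1) g(1)])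
    show "tgraft N \<tau> d (\<lambda>x. ap N (g' x) b) \<in> car N \<tau>" if "b \<in> car N \<sigma>" for b
      using that by (intro tgraft_in[OF N \<tau>] ap_in[OF N Fun.prems(1) g(2)])
    show "trel M N \<tau> (tgraft M \<tau> d (\<lambda>x. ap M (g x) a)) (tgraft N \<tau> d (\<lambda>x. ap N (g' x) b))"
      if "trel M N \<sigma> a b" for a b
      using that Fun.prems(2) by (intro Fun.IH(2)[OF \<tau>]) simp
  qed
qed

lemma unleaf_rel: "trel M N \<iota> a b \<Longrightarrow> unleaf M a = unleaf N b"
  using unleaf_leaf[OF M] unleaf_leaf[OF N] by auto

lemma const_sem_rel:
  assumes c: "const_ty c \<in> \<Union> (subtypes ` S)"
  shows "trel M N (const_ty c) (const_sem M c) (const_sem N c)"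
proof (cases c)
  case Zero
  then show ?thesis by auto
next
  case Succ
  have "trel M N (\<iota> \<rightarrowtriangle> \<iota>) (const_sem M Succ) (const_sem N Succ)"
    unfolding const_sem.simps
  proof (rule vabs_rel)
    show "\<iota> \<rightarrowtriangle> \<iota> \<in> \<Union> (subtypes ` S)" using c Succ by simp
    show "trel M N \<iota> (leaf M (dmap (\<lambda>n. n + 1) (unleaf M a))) (leaf N (dmap (\<lambda>n. n + 1) (unleaf N b)))"
      if "trel M N \<iota> a b" for a b
      unfolding unleaf_rel[OF that] by (rule leaf_rel)
  qed (simp_all add: leaf_in[OF M] leaf_in[OF N])
  then show ?thesis using Succ by simp
next
  case (Rec \<sigma>)
  let ?U = "\<Union> (subtypes ` S)"
  have U: "(\<iota> \<rightarrowtriangle> \<sigma> \<rightarrowtriangle> \<sigma>) \<rightarrowtriangle> \<sigma> \<rightarrowtriangle> \<iota> \<rightarrowtriangle> \<sigma> \<in> ?U" "\<iota> \<rightarrowtriangle> \<sigma> \<rightarrowtriangle> \<sigma> \<in> ?U"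
    "\<sigma> \<rightarrowtriangle> \<iota> \<rightarrowtriangle> \<sigma> \<in> ?U" "\<iota> \<rightarrowtriangle> \<sigma> \<in> ?U" "\<sigma> \<rightarrowtriangle> \<sigma> \<in> ?U" "\<sigma> \<in> ?U"
    using c Rec by (auto dest: subtypes_FunD)
  let ?rM = "\<lambda>f a. rec_nat a (\<lambda>n v. ap M (ap M f (leaf M (Eta n))) v)"
  let ?rN = "\<lambda>f a. rec_nat a (\<lambda>n v. ap N (ap N f (leaf N (Eta n))) v)"
  have rM: "?rM f a n \<in> car M \<sigma>"
    if "f \<in> car M (\<iota> \<rightarrowtriangle> \<sigma> \<rightarrowtriangle> \<sigma>)" "a \<in> car M \<sigma>" for f a n
    by (induction n) (use that in \<open>auto intro!: ap_in[OF M U(5)] ap_in[OF M U(2)] leaf_in[OF M]\<close>)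
  have rN: "?rN f a n \<in> car N \<sigma>"
    if "f \<in> car N (\<iota> \<rightarrowtriangle> \<sigma> \<rightarrowtriangle> \<sigma>)" "a \<in> car N \<sigma>" for f a n
    by (induction n) (use that in \<open>auto intro!: ap_in[OF N U(5)] ap_in[OF N U(2)] leaf_in[OF N]\<close>)
  have r: "trel M N \<sigma> (?rM f a n) (?rN g b n)"
    if "trel M N (\<iota> \<rightarrowtriangle> \<sigma> \<rightarrowtriangle> \<sigma>) f g" "trel M N \<sigma> a b" for f g a b n
    by (induction n) (use that in auto)
  let ?M3 = "\<lambda>f a d. tgraft M \<sigma> (unleaf M d) (?rM f a)"
  let ?N3 = "\<lambda>f a d. tgraft N \<sigma> (unleaf N d) (?rN f a)"
  have M3: "?M3 f a d \<in> car M \<sigma>" if "f \<in> car M (\<iota> \<rightarrowtriangle> \<sigma> \<rightarrowtriangle> \<sigma>)" "a \<in> car M \<sigma>" for f a d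
    by (rule tgraft_in[OF M U(6) rM[OF that]])
  have N3: "?N3 f a d \<in> car N \<sigma>" if "f \<in> car N (\<iota> \<rightarrowtriangle> \<sigma> \<rightarrowtriangle> \<sigma>)" "a \<in> car N \<sigma>" for f a d
    by (rule tgraft_in[OF N U(6) rN[OF that]])
  let ?M2 = "\<lambda>f a. vabs M \<iota> \<sigma> (?M3 f a)" and ?N2 = "\<lambda>f a. vabs N \<iota> \<sigma> (?N3 f a)"
  have M2: "?M2 f a \<in> car M (\<iota> \<rightarrowtriangle> \<sigma>)" if "f \<in> car M (\<iota> \<rightarrowtriangle> \<sigma> \<rightarrowtriangle> \<sigma>)" "a \<in> car M \<sigma>" for f a
    by (rule vabs_in[OF M U(4) M3[OF that]])
  have N2: "?N2 f a \<in> car N (\<iota> \<rightarrowtriangle> \<sigma>)" if "f \<in> car N (\<iota> \<rightarrowtriangle> \<sigma> \<rightarrowtriangle> \<sigma>)" "a \<in> car N \<sigma>" for f a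
    by (rule vabs_in[OF N U(4) N3[OF that]])
  have "trel M N (const_ty (Rec \<sigma>)) (const_sem M (Rec \<sigma>)) (const_sem N (Rec \<sigma>))"
    unfolding const_sem.simps const_ty.simps
  proof (rule vabs_rel[OF U(1)])
    fix f g assume fg: "trel M N (\<iota> \<rightarrowtriangle> \<sigma> \<rightarrowtriangle> \<sigma>) f g"
    note f = conjunct1[OF trel_in[OF fg]] and g = conjunct2[OF trel_in[OF fg]]
    show "trel M N (\<sigma> \<rightarrowtriangle> \<iota> \<rightarrowtriangle> \<sigma>) (vabs M \<sigma> (\<iota> \<rightarrowtriangle> \<sigma>) (?M2 f)) (vabs N \<sigma> (\<iota> \<rightarrowtriangle> \<sigma>) (?N2 g))"
    proof (rule vabs_rel[OF U(3) M2[OF f] N2[OF g]])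
      fix a b assume ab: "trel M N \<sigma> a b"
      note a = conjunct1[OF trel_in[OF ab]] and b = conjunct2[OF trel_in[OF ab]]
      show "trel M N (\<iota> \<rightarrowtriangle> \<sigma>) (?M2 f a) (?N2 g b)"
      proof (rule vabs_rel[OF U(4) M3[OF f a] N3[OF g b]])
        fix d e assume de: "trel M N \<iota> d e"
        show "trel M N \<sigma> (?M3 f a d) (?N3 g b e)"
          unfolding unleaf_rel[OF de] by (rule tgraft_rel[OF U(6) r[OF fg ab]])
      qed
    qed
  next
    show "vabs M \<sigma> (\<iota> \<rightarrowtriangle> \<sigma>) (?M2 f) \<in> car M (\<sigma> \<rightarrowtriangle> \<iota> \<rightarrowtriangle> \<sigma>)"
      if "f \<in> car M (\<iota> \<rightarrowtriangle> \<sigma> \<rightarrowtriangle> \<sigma>)" for f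
      by (rule vabs_in[OF M U(3) M2[OF that]])
    show "vabs N \<sigma> (\<iota> \<rightarrowtriangle> \<sigma>) (?N2 f) \<in> car N (\<sigma> \<rightarrowtriangle> \<iota> \<rightarrowtriangle> \<sigma>)"
      if "f \<in> car N (\<iota> \<rightarrowtriangle> \<sigma> \<rightarrowtriangle> \<sigma>)" for f
      by (rule vabs_in[OF N U(3) N2[OF that]])
  qed
  then show ?thesis by (simp only: Rec)
qed

lemma sem_rel:
  "has_type const_ty \<Gamma> t \<tau> \<Longrightarrow> types_in \<Gamma> t \<subseteq> \<Union> (subtypes ` S) \<Longrightarrow>
    length \<gamma> = length \<Gamma> \<Longrightarrow> length \<delta> = length \<Gamma> \<Longrightarrow>
    (\<And>i. i < length \<Gamma> \<Longrightarrow> trel M N (\<Gamma> ! i) (\<gamma> ! i) (\<delta> ! i)) \<Longrightarrow>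
    trel M N \<tau> (sem M \<Gamma> \<gamma> t) (sem N \<Gamma> \<delta> t)"
proof (induction arbitrary: \<gamma> \<delta> rule: has_type.induct)
  case (Lam \<sigma> \<Gamma> u \<tau>)
  note ty = has_type_type_of[OF Lam.hyps]
  have in_car: "\<gamma> ! i \<in> car M (\<Gamma> ! i)" "\<delta> ! i \<in> car N (\<Gamma> ! i)" if "i < length \<Gamma>" for i
    using trel_in[OF Lam.prems(4)[OF that]] by auto
  show ?case
    unfolding sem.simps ty
  proof (rule vabs_rel)
    show "\<sigma> \<rightarrowtriangle> \<tau> \<in> \<Union> (subtypes ` S)" using Lam.prems(1) ty by auto
    show "sem M (\<sigma> # \<Gamma>) (a # \<gamma>) u \<in> car M \<tau>" if "a \<in> car M \<sigma>" for a
      using that Lam.prems in_car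
      by (intro sem_in[OF M Lam.hyps]) (auto simp: nth_Cons split: nat.split)
    show "sem N (\<sigma> # \<Gamma>) (b # \<delta>) u \<in> car N \<tau>" if "b \<in> car N \<sigma>" for b
      using that Lam.prems in_car
      by (intro sem_in[OF N Lam.hyps]) (auto simp: nth_Cons split: nat.split)
    show "trel M N \<tau> (sem M (\<sigma> # \<Gamma>) (a # \<gamma>) u) (sem N (\<sigma> # \<Gamma>) (b # \<delta>) u)"
      if "trel M N \<sigma> a b" for a b
      using that Lam.prems by (intro Lam.IH) (auto simp: nth_Cons split: nat.split)
  qed
next
  case (App \<Gamma> u \<sigma> \<tau> v)
  then have "trel M N (\<sigma> \<rightarrowtriangle> \<tau>) (sem M \<Gamma> \<gamma> u) (sem N \<Gamma> \<delta> u)"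
    "trel M N \<sigma> (sem M \<Gamma> \<gamma> v) (sem N \<Gamma> \<delta> v)"
    by simp_all
  then show ?case by simp
next
  case (Const \<Gamma> c)
  then show ?case using const_sem_rel by simp
qed simp

end

lemma D_of_unique:
  fixes M :: "'v type_structure" and N :: "'w type_structure"
  assumes t: "has_type const_ty [] t ((\<iota> \<rightarrowtriangle> \<iota>) \<rightarrowtriangle> \<iota>)"
    and M: "full_on M (types_in [] t)" and N: "full_on N (types_in [] t)"
  shows "D_of M t = D_of N t"
proof -
  let ?U = "\<Union> (subtypes ` types_in [] t)"
  have "(\<iota> \<rightarrowtriangle> \<iota>) \<rightarrowtriangle> \<iota> \<in> ?U"
    using type_in_types_in[of "[]" t] has_type_type_of[OF t] subtypes_refl by force
  then have U: "\<iota> \<rightarrowtriangle> \<iota> \<in> ?U" by (auto dest: subtypes_FunD)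
  have "trel M N ((\<iota> \<rightarrowtriangle> \<iota>) \<rightarrowtriangle> \<iota>) (sem M [] [] t) (sem N [] [] t)"
    by (rule sem_rel[OF M N t]) (use subtypes_refl in auto)
  moreover have "trel M N (\<iota> \<rightarrowtriangle> \<iota>) (vabs M \<iota> \<iota> (\<lambda>d. leaf M (gen (unleaf M d))))
      (vabs N \<iota> \<iota> (\<lambda>d. leaf N (gen (unleaf N d))))"
  proof (rule vabs_rel[OF M N U])
    show "trel M N \<iota> (leaf M (gen (unleaf M a))) (leaf N (gen (unleaf N b)))"
      if "trel M N \<iota> a b" for a b
      unfolding unleaf_rel[OF M N that] by (rule leaf_rel[OF M N])
  qed (simp_all add: leaf_in[OF M] leaf_in[OF N])
  ultimately show ?thesis
    unfolding D_of_def by (intro unleaf_rel[OF M N]) (simp del: trel.simps(1))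
qed

paragraph \<open>Type structures that are full on all types of bounded depth exist\<close>

primrec ty_depth :: "ty \<Rightarrow> nat" where
  "ty_depth \<iota> = 0"
| "ty_depth (\<sigma> \<rightarrowtriangle> \<tau>) = Suc (max (ty_depth \<sigma>) (ty_depth \<tau>))"

lemma ty_depth_subtypes: "\<sigma> \<in> subtypes \<rho> \<Longrightarrow> ty_depth \<sigma> \<le> ty_depth \<rho>"
  by (induction \<rho>) auto

lemma full_on_depth_iff:
  "full_on M {\<rho>. ty_depth \<rho> \<le> n} \<longleftrightarrow>
     bij_betw (leaf M) UNIV (car M \<iota>) \<and>
     (\<forall>\<sigma> \<tau>. ty_depth \<sigma> < n \<and> ty_depth \<tau> < n \<longrightarrow>
        bij_betw (\<lambda>f. restrict (ap M f) (car M \<sigma>)) (car M (\<sigma> \<rightarrowtriangle> \<tau>)) (car M \<sigma> \<rightarrow>\<^sub>E car M \<tau>))"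
proof -
  have "\<Union> (subtypes ` {\<rho>. ty_depth \<rho> \<le> n}) = {\<rho>. ty_depth \<rho> \<le> n}"
    using subtypes_refl by (auto dest!: ty_depth_subtypes intro: order_trans)
  then show ?thesis unfolding full_on_def by (auto simp: Suc_le_eq)
qed

lemma full_on_types_in:
  obtains n where "types_in \<Gamma> t \<subseteq> {\<rho>. ty_depth \<rho> \<le> n}"
proof -
  have "finite (types_in \<Gamma> t)" by (induction t arbitrary: \<Gamma>) simp_all
  then have "finite (ty_depth ` types_in \<Gamma> t)" by simp
  then show ?thesis using that by (auto simp: finite_nat_set_iff_bounded_le)
qed

lemma full_on_base: "\<exists>M :: nat dialogue type_structure. full_on M {\<rho>. ty_depth \<rho> \<le> 0}"
  by (rule exI[of _ "\<lparr>car = \<lambda>_. UNIV, leaf = id, ap = \<lambda>_. id\<rparr>"])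
     (simp only: full_on_depth_iff, simp)

lemma full_on_step:
  fixes M :: "'v type_structure"
  assumes M: "full_on M {\<rho>. ty_depth \<rho> \<le> n}"
  shows "\<exists>M' :: ('v + ('v \<Rightarrow> 'v)) type_structure. full_on M' {\<rho>. ty_depth \<rho> \<le> Suc n}"
proof -
  define M' :: "('v + ('v \<Rightarrow> 'v)) type_structure" where
    "M' = \<lparr>car = \<lambda>\<rho>. if ty_depth \<rho> \<le> n then Inl ` car M \<rho> else
             (case \<rho> of \<iota> \<Rightarrow> {} | \<sigma> \<rightarrowtriangle> \<tau> \<Rightarrow> Inr ` (car M \<sigma> \<rightarrow>\<^sub>E car M \<tau>)),
           leaf = Inl \<circ> leaf M,
           ap = \<lambda>f a. Inl (case f of Inl f' \<Rightarrow> ap M f' (projl a) | Inr F \<Rightarrow> F (projl a))\<rparr>"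
  have car1: "car M' \<rho> = Inl ` car M \<rho>" if "ty_depth \<rho> \<le> n" for \<rho>
    using that by (simp add: M'_def)
  have lift: "bij_betw (\<lambda>f. \<lambda>a\<in>Inl ` A. Inl (f (projl a)) :: 'v + ('v \<Rightarrow> 'v))
      (A \<rightarrow>\<^sub>E B) ((Inl ` A :: ('v + ('v \<Rightarrow> 'v)) set) \<rightarrow>\<^sub>E Inl ` B)" for A B :: "'v set"
  proof (rule bij_betw_byWitness[where f' = "\<lambda>F. \<lambda>a\<in>A. projl (F (Inl a))"])
    show "\<forall>f\<in>A \<rightarrow>\<^sub>E B. (\<lambda>a\<in>A. projl ((\<lambda>a\<in>(Inl ` A :: ('v + ('v \<Rightarrow> 'v)) set). Inl (f (projl a)) :: 'v + ('v \<Rightarrow> 'v)) (Inl a))) = f"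
      by (auto simp: fun_eq_iff PiE_def extensional_def)
    show "\<forall>F\<in>(Inl ` A :: ('v + ('v \<Rightarrow> 'v)) set) \<rightarrow>\<^sub>E Inl ` B.
        (\<lambda>a\<in>Inl ` A. Inl ((\<lambda>a\<in>A. projl (F (Inl a))) (projl a)) :: 'v + ('v \<Rightarrow> 'v)) = F"
    proof
      fix F :: "'v + ('v \<Rightarrow> 'v) \<Rightarrow> 'v + ('v \<Rightarrow> 'v)" assume F: "F \<in> Inl ` A \<rightarrow>\<^sub>E Inl ` B"
      have "Inl (projl (F (Inl a))) = F (Inl a)" if "a \<in> A" for a
        using PiE_mem[OF F, of "Inl a"] that by auto
      moreover have "F x = undefined" if "x \<notin> Inl ` A" for x
        using PiE_arb[OF F that] .
      ultimately show "(\<lambda>a\<in>Inl ` A. Inl ((\<lambda>a\<in>A. projl (F (Inl a))) (projl a)) :: 'v + ('v \<Rightarrow> 'v)) = F"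
        by (auto simp: fun_eq_iff)
    qed
    show "(\<lambda>f. \<lambda>a\<in>Inl ` A. Inl (f (projl a)) :: 'v + ('v \<Rightarrow> 'v)) ` (A \<rightarrow>\<^sub>E B) \<subseteq> (Inl ` A :: ('v + ('v \<Rightarrow> 'v)) set) \<rightarrow>\<^sub>E Inl ` B"
      by (auto simp: PiE_def Pi_def)
    show "(\<lambda>F. \<lambda>a\<in>A. projl (F (Inl a))) ` ((Inl ` A :: ('v + ('v \<Rightarrow> 'v)) set) \<rightarrow>\<^sub>E (Inl ` B :: ('v + ('v \<Rightarrow> 'v)) set)) \<subseteq> A \<rightarrow>\<^sub>E B"
    proof (rule image_subsetI)
      fix F :: "'v + ('v \<Rightarrow> 'v) \<Rightarrow> 'v + ('v \<Rightarrow> 'v)" assume F: "F \<in> Inl ` A \<rightarrow>\<^sub>E Inl ` B"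
      show "(\<lambda>a\<in>A. projl (F (Inl a))) \<in> A \<rightarrow>\<^sub>E B"
        using PiE_mem[OF F] by (intro restrict_PiE_iff[THEN iffD2] ballI) force
    qed
  qed
  have "bij_betw (\<lambda>f. restrict (ap M' f) (car M' \<sigma>)) (car M' (\<sigma> \<rightarrowtriangle> \<tau>)) (car M' \<sigma> \<rightarrow>\<^sub>E car M' \<tau>)"
    if "ty_depth \<sigma> < Suc n" "ty_depth \<tau> < Suc n" for \<sigma> \<tau>
  proof (cases "ty_depth (\<sigma> \<rightarrowtriangle> \<tau>) \<le> n")
    case True
    then have "ty_depth \<sigma> < n" "ty_depth \<tau> < n" by auto
    then have 1: "bij_betw (\<lambda>f. restrict (ap M f) (car M \<sigma>)) (car M (\<sigma> \<rightarrowtriangle> \<tau>)) (car M \<sigma> \<rightarrow>\<^sub>E car M \<tau>)"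
      using M unfolding full_on_depth_iff by blast
    have 2: "bij_betw projl (Inl ` car M (\<sigma> \<rightarrowtriangle> \<tau>) :: ('v + ('v \<Rightarrow> 'v)) set) (car M (\<sigma> \<rightarrowtriangle> \<tau>))"
      by (auto simp: bij_betw_def inj_on_def image_image)
    have eq: "restrict (ap M' f) (car M' \<sigma>) = ((\<lambda>f. \<lambda>a\<in>Inl ` car M \<sigma>. Inl (f (projl a))) \<circ>
        ((\<lambda>f. restrict (ap M f) (car M \<sigma>)) \<circ> projl)) f" if "f \<in> car M' (\<sigma> \<rightarrowtriangle> \<tau>)" for f
      using that \<open>ty_depth \<sigma> < n\<close> True
      by (auto simp: car1 fun_eq_iff) (auto simp: M'_def)
    have cars: "car M' (\<sigma> \<rightarrowtriangle> \<tau>) = Inl ` car M (\<sigma> \<rightarrowtriangle> \<tau>)"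
      "car M' \<sigma> = Inl ` car M \<sigma>" "car M' \<tau> = Inl ` car M \<tau>"
      using that True by (simp_all only: car1 less_Suc_eq_le)
    show ?thesis
      unfolding cars
      by (subst bij_betw_cong[OF eq[unfolded cars]], assumption)
         (rule bij_betw_trans[OF bij_betw_trans[OF 2 1] lift])
  next
    case False
    have car2: "car M' (\<sigma> \<rightarrowtriangle> \<tau>) = Inr ` (car M \<sigma> \<rightarrow>\<^sub>E car M \<tau>)"
      using False by (simp add: M'_def)
    have 2: "bij_betw projr (Inr ` (car M \<sigma> \<rightarrow>\<^sub>E car M \<tau>) :: ('v + ('v \<Rightarrow> 'v)) set)
        (car M \<sigma> \<rightarrow>\<^sub>E car M \<tau>)"
      by (auto simp: bij_betw_def inj_on_def image_image)
    have eq: "restrict (ap M' f) (car M' \<sigma>) =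
        ((\<lambda>f. \<lambda>a\<in>Inl ` car M \<sigma>. Inl (f (projl a))) \<circ> projr) f" if "f \<in> car M' (\<sigma> \<rightarrowtriangle> \<tau>)" for f
      using that \<open>ty_depth \<sigma> < Suc n\<close>
      by (auto simp: car1 car2 fun_eq_iff) (auto simp: M'_def)
    have cars: "car M' \<sigma> = Inl ` car M \<sigma>" "car M' \<tau> = Inl ` car M \<tau>"
      using that by (simp_all only: car1 less_Suc_eq_le)
    show ?thesis
      unfolding cars car2
      by (subst bij_betw_cong[OF eq[unfolded cars car2]], assumption)
         (rule bij_betw_trans[OF 2 lift])
  qed
  moreover have "bij_betw (leaf M') UNIV (car M' \<iota>)"
    using M unfolding full_on_depth_iff M'_def
    by (auto simp: bij_betw_def inj_on_def image_comp[symmetric])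
  ultimately show ?thesis by (auto simp: full_on_depth_iff)
qed

end

theory Submission
  imports Defs
begin

text \<open>
  The interpretation of a term is derived in an infinitary calculus whose judgements speak about
  functions from valuations to values, so that beta-reduction is an identity of values and only
  its effect on ordinal heights matters. Variables are \<open>\<eta>\<close>-expanded at a finite cost, and
  \<open>Rec\<close> becomes a graft over \<open>\<nat>\<close> of derivations of finite height. Therefore \<open>t \<Omega>\<close> has a
  derivation of height \<open>\<omega> + m(t)\<close> whose cuts have level at most \<open>K(t)\<close>. Eliminating the cuts of the
  highest level turns height \<open>\<alpha>\<close> into \<open>2\<^sup>\<alpha>\<close>, because substituting a derivation of height \<open>\<beta>\<close> into
  one of height \<open>\<alpha>\<close> gives height \<open>\<beta> + \<alpha>\<close>. After \<open>K(t)\<close> steps the remaining cuts are grafts, and a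
  closed derivation of height \<open>\<alpha>\<close> with no other cuts denotes a tree of height at most \<open>2\<^sup>\<alpha>\<close>.
\<close>

section \<open>Ordinals\<close>

text \<open>The sum \<open>2 \<up> b + 2 \<up> b\<close> is \<open>2 \<up> osucc b\<close>, and
  \<open>osucc b \<le> a\<close>. This doubling pays both for contracting a cut and for evaluating a
  graft.\<close>

lemma zero_less_two_opow: "0 < 2 \<up> a"
  and two_opow_double: "b < a \<Longrightarrow> 2 \<up> b + 2 \<up> b \<le> 2 \<up> a"
proof -
  have two: "(2 :: ordinal) = osucc 1"
    by (simp add: plus_one_ordinal flip: one_add_one)
  have zero_less_one: "(0 :: ordinal) < 1"
    by (simp add: one_ordinal_eq)
  have nonzero: "(2 :: ordinal) \<noteq> 0"
    unfolding two by (metis less_osucc not_less_zero_ordinal)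
  have "1 \<le> 2 \<up> a" for a
    using opow_le_iff[OF nonzero, of a "2 \<up> a"] by simp
  then show "0 < 2 \<up> a"
    using zero_less_one by (rule less_le_trans[rotated])
  assume "b < a"
  have "2 \<up> b + 2 \<up> b = 2 \<up> b * osucc (osucc 0)"
    by (simp add: times_ordinal_osucc times_ordinal_zero)
  also have "\<dots> = 2 \<up> osucc b"
    by (simp add: opow_osucc two one_ordinal_eq)
  also have "\<dots> \<le> 2 \<up> a"
    using \<open>b < a\<close> nonzero by (intro opow_mono) (simp_all add: osucc_le_iff)
  finally show "2 \<up> b + 2 \<up> b \<le> 2 \<up> a" .
qed

lemma two_opow_strict_mono:
  assumes "b < a"
  shows "2 \<up> b < 2 \<up> a"
proof -
  have "2 \<up> b + 0 < 2 \<up> b + 2 \<up> b"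
    using zero_less_two_opow by (rule plus_ordinal_strict_mono)
  then show ?thesis
    using two_opow_double[OF assms] by simp
qed

lemma ord_of_nat_strict_mono: "m < n \<Longrightarrow> ord_of_nat m < ord_of_nat n"
  by (rule lift_Suc_mono_less) (simp_all add: plus_one_ordinal)

lemma ord_of_nat_mono: "m \<le> n \<Longrightarrow> ord_of_nat m \<le> ord_of_nat n"
  using ord_of_nat_strict_mono by (cases "m = n") (auto simp: order_le_less)

lemma ord_of_nat_le_omega: "ord_of_nat n \<le> \<omega>"
  unfolding omega_def by (intro cSup_upper countable_imp_bdd_above) auto

lemma omega_plus_strict_mono: "m < n \<Longrightarrow> \<omega> + ord_of_nat m < \<omega> + ord_of_nat n"
  by (intro plus_ordinal_strict_mono ord_of_nat_strict_mono)

lemma omega_plus_mono: "m \<le> n \<Longrightarrow> \<omega> + ord_of_nat m \<le> \<omega> + ord_of_nat n"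
  by (intro plus_ordinal_mono_right ord_of_nat_mono)

lemma ord_of_nat_le_omega_plus: "ord_of_nat n \<le> \<omega> + a"
  using ord_of_nat_le_omega le_plus_ordinal by (rule order_trans)

section \<open>Heights of grafted trees\<close>

lemma height_Beta_le_iff: "height (Beta i \<phi>) \<le> a \<longleftrightarrow> (\<forall>n. height (\<phi> n) + 1 \<le> a)"
  by (simp add: countable_cSup_le_iff)

text \<open>The bound \<open>b\<close> stands on the left because the grafted trees replace the
  leaves of \<open>d\<close>: the nodes of \<open>d\<close> then add their successors on top, that
  is, on the right.\<close>

lemma height_graft_le:
  assumes "\<And>x. height (g x) \<le> b"
  shows "height (graft d g) \<le> b + height d"
proof (induction d)
  case (Eta x)
  show ?case using assms by simp
next
  case (Beta i \<phi>)
  have "height (graft (\<phi> n) g) + 1 \<le> b + height (Beta i \<phi>)" for n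
  proof -
    have "height (graft (\<phi> n) g) + 1 \<le> b + (height (\<phi> n) + 1)"
      using Beta by (simp add: plus_ordinal_mono flip: add.assoc)
    also have "\<dots> \<le> b + height (Beta i \<phi>)"
      using height_Beta_le_iff[of i \<phi> "height (Beta i \<phi>)"] by (intro plus_ordinal_mono_right) blast
    finally show ?thesis .
  qed
  then show ?case by (simp only: graft.simps height_Beta_le_iff) simp
qed

section \<open>The infinitary calculus\<close>

text \<open>Valuations are total and constrained only on the domain of the context, so that
  extension is \<open>case_nat\<close> and renaming is composition.\<close>

definition valuations :: "'v type_structure \<Rightarrow> (nat \<Rightarrow> ty option) \<Rightarrow> (nat \<Rightarrow> 'v) set" where
  "valuations M \<Gamma> = {\<gamma>. \<forall>i \<sigma>. \<Gamma> i = Some \<sigma> \<longrightarrow> \<gamma> i \<in> car M \<sigma>}"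

text \<open>
  The flag is \<open>True\<close> for neutral judgements, those headed by a variable; only neutral judgements
  of type \<open>\<iota>\<close> are coerced to general ones, so a general judgement of function type whose level
  exceeds the cut rank \<open>r\<close> can only come from \<open>Lam\<close>. The two premises of a graft must have a
  common height bound: with heights merely cofinal in \<open>\<alpha>\<close> the bound \<open>2\<^sup>\<alpha>\<close> on trees would fail.
\<close>

inductive derivable ::
  "'v type_structure \<Rightarrow> ty set \<Rightarrow> nat \<Rightarrow> bool \<Rightarrow> ordinal \<Rightarrow> (nat \<Rightarrow> ty option) \<Rightarrow> ty \<Rightarrow>
    ((nat \<Rightarrow> 'v) \<Rightarrow> 'v) \<Rightarrow> bool"
  for M U r where
  Var: "\<Gamma> i = Some \<sigma> \<Longrightarrow> (\<And>\<gamma>. \<gamma> \<in> valuations M \<Gamma> \<Longrightarrow> H \<gamma> = \<gamma> i) \<Longrightarrow>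
    derivable M U r True \<alpha> \<Gamma> \<sigma> H"
| App: "derivable M U r ne \<beta> \<Gamma> (\<sigma> \<rightarrowtriangle> \<tau>) F \<Longrightarrow> derivable M U r False \<beta> \<Gamma> \<sigma> G \<Longrightarrow>
    \<sigma> \<rightarrowtriangle> \<tau> \<in> U \<Longrightarrow> ne \<or> lev (\<sigma> \<rightarrowtriangle> \<tau>) \<le> r \<Longrightarrow> \<beta> < \<alpha> \<Longrightarrow>
    (\<And>\<gamma>. \<gamma> \<in> valuations M \<Gamma> \<Longrightarrow> H \<gamma> = ap M (F \<gamma>) (G \<gamma>)) \<Longrightarrow>
    derivable M U r ne \<alpha> \<Gamma> \<tau> H"
| Coerce: "derivable M U r True \<alpha> \<Gamma> \<iota> H \<Longrightarrow> derivable M U r False \<alpha> \<Gamma> \<iota> H"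
| Lam: "derivable M U r False \<beta> (case_nat (Some \<sigma>) \<Gamma>) \<tau> F \<Longrightarrow> \<sigma> \<rightarrowtriangle> \<tau> \<in> U \<Longrightarrow> \<beta> < \<alpha> \<Longrightarrow>
    (\<And>\<gamma>. \<gamma> \<in> valuations M \<Gamma> \<Longrightarrow> H \<gamma> = vabs M \<sigma> \<tau> (\<lambda>a. F (case_nat a \<gamma>))) \<Longrightarrow>
    derivable M U r False \<alpha> \<Gamma> (\<sigma> \<rightarrowtriangle> \<tau>) H"
| Graft: "derivable M U r False \<beta> \<Gamma> \<iota> E \<Longrightarrow> (\<And>n. derivable M U r False \<beta> \<Gamma> \<iota> (F n)) \<Longrightarrow> \<beta> < \<alpha> \<Longrightarrow>
    (\<And>\<gamma>. \<gamma> \<in> valuations M \<Gamma> \<Longrightarrow> H \<gamma> = leaf M (graft (unleaf M (E \<gamma>)) (\<lambda>n. unleaf M (F n \<gamma>)))) \<Longrightarrow>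
    derivable M U r False \<alpha> \<Gamma> \<iota> H"
| Leaf: "height d \<le> 1 \<Longrightarrow> (\<And>\<gamma>. \<gamma> \<in> valuations M \<Gamma> \<Longrightarrow> H \<gamma> = leaf M d) \<Longrightarrow>
    derivable M U r False \<alpha> \<Gamma> \<iota> H"

section \<open>Monotonicity and renaming of derivations\<close>

text \<open>The rules determine \<open>H\<close> only on \<open>valuations M \<Gamma>\<close> and
  constrain the height only from below, so both can be changed in the last rule;
  \<open>Coerce\<close> passes the change on to its premise.\<close>

lemma derivable_mono:
  assumes "derivable M U r ne \<alpha> \<Gamma> \<tau> F" "\<alpha> \<le> \<alpha>'" "\<And>\<gamma>. \<gamma> \<in> valuations M \<Gamma> \<Longrightarrow> F' \<gamma> = F \<gamma>"
  shows "derivable M U r ne \<alpha>' \<Gamma> \<tau> F'"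
  using assms
proof (induction arbitrary: \<alpha>' F' rule: derivable.induct)
  case (Var \<Gamma> i \<sigma> H \<alpha>)
  then show ?case by (intro derivable.Var) auto
next
  case (App ne \<beta> \<Gamma> \<sigma> \<tau> F G \<alpha> H)
  show ?case
    by (rule derivable.App[OF App.hyps(1-4)]) (use App.hyps App.prems in auto)
next
  case (Coerce \<alpha> \<Gamma> H)
  then show ?case by (blast intro: derivable.Coerce)
next
  case (Lam \<beta> \<sigma> \<Gamma> \<tau> F \<alpha> H)
  show ?case
    by (rule derivable.Lam[OF Lam.hyps(1-2)]) (use Lam.hyps Lam.prems in auto)
next
  case (Graft \<beta> \<Gamma> E F \<alpha> H)
  show ?case
    by (rule derivable.Graft[OF Graft.hyps(1-2)]) (use Graft.hyps Graft.prems in auto)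
next
  case (Leaf d \<Gamma> H \<alpha>)
  then show ?case by (intro derivable.Leaf) auto
qed

lemma valuations_extend_iff:
  "\<delta> \<in> valuations M (case_nat (Some \<sigma>) \<Gamma>) \<longleftrightarrow> \<delta> 0 \<in> car M \<sigma> \<and> \<delta> \<circ> Suc \<in> valuations M \<Gamma>"
  by (auto simp: valuations_def split: nat.splits)

lemma case_nat_comp_Suc [simp]: "case_nat a \<gamma> \<circ> Suc = \<gamma>"
  by (simp add: fun_eq_iff)

lemma derivable_rename:
  assumes "derivable M U r ne \<alpha> \<Gamma> \<tau> F" "\<And>i \<sigma>. \<Gamma> i = Some \<sigma> \<Longrightarrow> \<Delta> (\<rho> i) = Some \<sigma>"
  shows "derivable M U r ne \<alpha> \<Delta> \<tau> (\<lambda>\<delta>. F (\<delta> \<circ> \<rho>))"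
  using assms
proof (induction arbitrary: \<Delta> \<rho> rule: derivable.induct)
  case (Var \<Gamma> i \<sigma> H \<alpha>)
  then show ?case by (intro derivable.Var[where i = "\<rho> i"]) (auto simp: valuations_def)
next
  case (App ne \<beta> \<Gamma> \<sigma> \<tau> F G \<alpha> H)
  show ?case
    by (rule derivable.App[OF App.IH App.hyps(3-5)])
      (use App.hyps App.prems in \<open>auto simp: valuations_def\<close>)
next
  case (Coerce \<alpha> \<Gamma> H)
  then show ?case by (blast intro: derivable.Coerce)
next
  case (Lam \<beta> \<sigma> \<Gamma> \<tau> F \<alpha> H)
  let ?\<rho> = "case_nat 0 (\<lambda>i. Suc (\<rho> i))"
  have eq: "case_nat a \<delta> \<circ> ?\<rho> = case_nat a (\<delta> \<circ> \<rho>)" for a and \<delta> :: "nat \<Rightarrow> 'a"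
    by (auto simp: fun_eq_iff split: nat.split)
  show ?case
  proof (rule derivable.Lam[where F = "\<lambda>\<delta>. F (\<delta> \<circ> ?\<rho>)"])
    show "derivable M U r False \<beta> (case_nat (Some \<sigma>) \<Delta>) \<tau> (\<lambda>\<delta>. F (\<delta> \<circ> ?\<rho>))"
      by (rule Lam.IH) (use Lam.prems in \<open>auto split: nat.splits\<close>)
    show "H (\<delta> \<circ> \<rho>) = vabs M \<sigma> \<tau> (\<lambda>a. F (case_nat a \<delta> \<circ> ?\<rho>))" if "\<delta> \<in> valuations M \<Delta>" for \<delta>
      unfolding eq using that Lam.prems by (intro Lam.hyps) (auto simp: valuations_def)
  qed (use Lam.hyps in auto)
next
  case (Graft \<beta> \<Gamma> E F \<alpha> H)
  show ?case
    by (rule derivable.Graft[OF Graft.IH Graft.hyps(3)])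
      (use Graft.hyps Graft.prems in \<open>auto simp: valuations_def\<close>)
next
  case (Leaf d \<Gamma> H \<alpha>)
  then show ?case by (intro derivable.Leaf[where d = d]) (auto simp: valuations_def)
qed

section \<open>Substitution\<close>

text \<open>A variable of any level may be sent to a variable, which keeps a neutral head neutral.
  Any other image may become the head of a cut, so its level is bounded by \<open>r\<close>.\<close>

definition substitution ::
  "'v type_structure \<Rightarrow> ty set \<Rightarrow> nat \<Rightarrow> ordinal \<Rightarrow> (nat \<Rightarrow> ty option) \<Rightarrow> (nat \<Rightarrow> ty option) \<Rightarrow>
    ((nat \<Rightarrow> 'v) \<Rightarrow> nat \<Rightarrow> 'v) \<Rightarrow> bool" where
  "substitution M U r \<beta> \<Gamma> \<Delta> s \<longleftrightarrow> (\<forall>i \<sigma>. \<Gamma> i = Some \<sigma> \<longrightarrow>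
    (\<exists>j. \<Delta> j = Some \<sigma> \<and> (\<forall>\<delta>. s \<delta> i = \<delta> j)) \<or>
    lev \<sigma> \<le> r \<and> derivable M U r False \<beta> \<Delta> \<sigma> (\<lambda>\<delta>. s \<delta> i))"

lemma derivable_weaken:
  "derivable M U r ne \<alpha> \<Gamma> \<tau> F \<Longrightarrow>
    derivable M U r ne \<alpha> (case_nat (Some \<sigma>) \<Gamma>) \<tau> (\<lambda>\<delta>. F (\<delta> \<circ> Suc))"
  by (rule derivable_rename) auto

lemma substitution_extend:
  fixes s :: "(nat \<Rightarrow> 'v) \<Rightarrow> nat \<Rightarrow> 'v"
  assumes "substitution M U r \<beta> \<Gamma> \<Delta> s"
  shows "substitution M U r \<beta> (case_nat (Some \<sigma>) \<Gamma>) (case_nat (Some \<sigma>) \<Delta>)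
    (\<lambda>\<delta>. case_nat (\<delta> 0) (s (\<delta> \<circ> Suc)))"
  unfolding substitution_def
proof (intro allI impI)
  fix i \<upsilon> assume i: "case_nat (Some \<sigma>) \<Gamma> i = Some \<upsilon>"
  let ?s = "\<lambda>\<delta> :: nat \<Rightarrow> 'v. case_nat (\<delta> 0) (s (\<delta> \<circ> Suc))"
  show "(\<exists>j. case_nat (Some \<sigma>) \<Delta> j = Some \<upsilon> \<and> (\<forall>\<delta>. ?s \<delta> i = \<delta> j)) \<or>
      lev \<upsilon> \<le> r \<and> derivable M U r False \<beta> (case_nat (Some \<sigma>) \<Delta>) \<upsilon> (\<lambda>\<delta>. ?s \<delta> i)"
  proof (cases i)
    case 0
    with i show ?thesis by (intro disjI1 exI[of _ 0]) simp
  next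
    case (Suc k)
    with i have "\<Gamma> k = Some \<upsilon>" by simp
    with assms consider j where "\<Delta> j = Some \<upsilon>" "\<And>\<delta>. s \<delta> k = \<delta> j"
      | "lev \<upsilon> \<le> r" "derivable M U r False \<beta> \<Delta> \<upsilon> (\<lambda>\<delta>. s \<delta> k)"
      unfolding substitution_def by blast
    then show ?thesis
    proof cases
      case (1 j)
      then show ?thesis by (intro disjI1 exI[of _ "Suc j"]) (simp add: Suc)
    next
      case 2
      then show ?thesis using derivable_weaken[OF 2(2)] by (simp add: Suc)
    qed
  qed
qed

context
  fixes M :: "'v type_structure" and S U :: "ty set"
  assumes M: "full_on M S" and U: "U = \<Union> (subtypes ` S)"
begin

lemma U_FunD: "\<sigma> \<rightarrowtriangle> \<tau> \<in> U \<Longrightarrow> \<sigma> \<in> U" "\<sigma> \<rightarrowtriangle> \<tau> \<in> U \<Longrightarrow> \<tau> \<in> U"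
  unfolding U by (auto dest: subtypes_FunD)

text \<open>This is the injectivity half of fullness. It makes eta an identity of values, so that an
  eta-expanded judgement still denotes the same function.\<close>

lemma vabs_ap:
  assumes "\<sigma> \<rightarrowtriangle> \<tau> \<in> U" "f \<in> car M (\<sigma> \<rightarrowtriangle> \<tau>)"
  shows "vabs M \<sigma> \<tau> (ap M f) = f"
proof -
  have "inj_on (\<lambda>f. restrict (ap M f) (car M \<sigma>)) (car M (\<sigma> \<rightarrowtriangle> \<tau>))"
    using M assms(1) unfolding U full_on_def bij_betw_def by blast
  then show ?thesis
    unfolding vabs_def using assms(2) by (rule inv_into_f_f)
qed

text \<open>The laws \<open>ap_vabs\<close> and \<open>vabs_ap\<close> hold only on the carriers;
  this supplies the membership they require.\<close>

lemma derivable_in_car: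
  "derivable M U r ne \<alpha> \<Gamma> \<tau> F \<Longrightarrow> \<gamma> \<in> valuations M \<Gamma> \<Longrightarrow> F \<gamma> \<in> car M \<tau>"
proof (induction arbitrary: \<gamma> rule: derivable.induct)
  case (Var \<Gamma> i \<sigma> H \<alpha>)
  then show ?case by (auto simp: valuations_def)
next
  case (App ne \<beta> \<Gamma> \<sigma> \<tau> F G \<alpha> H)
  then show ?case using ap_in[OF M] U by auto
next
  case (Lam \<beta> \<sigma> \<Gamma> \<tau> F \<alpha> H)
  have "vabs M \<sigma> \<tau> (\<lambda>a. F (case_nat a \<gamma>)) \<in> car M (\<sigma> \<rightarrowtriangle> \<tau>)"
    using Lam by (intro vabs_in[OF M]) (auto simp: U valuations_extend_iff)
  then show ?case using Lam by simp
qed (auto simp: leaf_in[OF M])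

lemma substitution_valuations:
  assumes "substitution M U r \<beta> \<Gamma> \<Delta> s" "\<delta> \<in> valuations M \<Delta>"
  shows "s \<delta> \<in> valuations M \<Gamma>"
  unfolding valuations_def
proof (intro CollectI allI impI)
  fix i \<sigma> assume "\<Gamma> i = Some \<sigma>"
  with assms(1) consider j where "\<Delta> j = Some \<sigma>" "\<And>\<delta>. s \<delta> i = \<delta> j"
    | "derivable M U r False \<beta> \<Delta> \<sigma> (\<lambda>\<delta>. s \<delta> i)"
    unfolding substitution_def by blast
  then show "s \<delta> i \<in> car M \<sigma>"
    using assms(2) derivable_in_car by cases (auto simp: valuations_def)
qed

text \<open>
  Replacing the head of a neutral judgement turns it into a cut, whose level is at most that of
  the replaced variable; hence the second alternative.
\<close>

lemma derivable_subst:
  assumes "derivable M U r ne \<alpha> \<Gamma> \<tau> F" "substitution M U r \<beta> \<Gamma> \<Delta> s"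
  shows "derivable M U r ne (\<beta> + \<alpha>) \<Delta> \<tau> (\<lambda>\<delta>. F (s \<delta>)) \<or>
    lev \<tau> \<le> r \<and> derivable M U r False (\<beta> + \<alpha>) \<Delta> \<tau> (\<lambda>\<delta>. F (s \<delta>))"
  using assms
proof (induction arbitrary: \<Delta> s rule: derivable.induct)
  case (Var \<Gamma> i \<sigma> H \<alpha>)
  have H: "H (s \<delta>) = s \<delta> i" if "\<delta> \<in> valuations M \<Delta>" for \<delta>
    using substitution_valuations[OF Var.prems that] by (rule Var.hyps(2))
  from Var consider j where "\<Delta> j = Some \<sigma>" "\<And>\<delta>. s \<delta> i = \<delta> j"
    | "lev \<sigma> \<le> r" "derivable M U r False \<beta> \<Delta> \<sigma> (\<lambda>\<delta>. s \<delta> i)"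
    unfolding substitution_def by blast
  then show ?case
  proof cases
    case (1 j)
    then have "derivable M U r True (\<beta> + \<alpha>) \<Delta> \<sigma> (\<lambda>\<delta>. H (s \<delta>))"
      using H by (intro derivable.Var) auto
    then show ?thesis by blast
  next
    case 2
    from derivable_mono[OF 2(2) le_plus_ordinal H] 2(1) show ?thesis by blast
  qed
next
  case (App ne \<eta> \<Gamma> \<sigma> \<tau> F G \<alpha> H)
  note s = substitution_valuations[OF App.prems]
  have G: "derivable M U r False (\<beta> + \<eta>) \<Delta> \<sigma> (\<lambda>\<delta>. G (s \<delta>))"
    using App.IH(2)[OF App.prems] by blast
  have *: "derivable M U r ne' (\<beta> + \<alpha>) \<Delta> \<tau> (\<lambda>\<delta>. H (s \<delta>))"
    if "derivable M U r ne' (\<beta> + \<eta>) \<Delta> (\<sigma> \<rightarrowtriangle> \<tau>) (\<lambda>\<delta>. F (s \<delta>))" "ne' \<or> lev (\<sigma> \<rightarrowtriangle> \<tau>) \<le> r" for ne'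
    using that(1) G App.hyps(3) that(2) plus_ordinal_strict_mono[OF App.hyps(5)]
    by (rule derivable.App) (use s App.hyps(6) in auto)
  from App.IH(1)[OF App.prems] show ?case
  proof (elim disjE conjE)
    assume "derivable M U r ne (\<beta> + \<eta>) \<Delta> (\<sigma> \<rightarrowtriangle> \<tau>) (\<lambda>\<delta>. F (s \<delta>))"
    from *[OF this App.hyps(4)] show ?thesis ..
  next
    assume "lev (\<sigma> \<rightarrowtriangle> \<tau>) \<le> r" "derivable M U r False (\<beta> + \<eta>) \<Delta> (\<sigma> \<rightarrowtriangle> \<tau>) (\<lambda>\<delta>. F (s \<delta>))"
    with *[of False] show ?thesis by simp
  qed
next
  case (Coerce \<alpha> \<Gamma> H)
  then show ?case by (blast intro: derivable.Coerce)
next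
  case (Lam \<eta> \<sigma> \<Gamma> \<tau> F \<alpha> H)
  let ?s = "\<lambda>\<delta> :: nat \<Rightarrow> 'v. case_nat (\<delta> 0) (s (\<delta> \<circ> Suc))"
  note F = Lam.IH[OF substitution_extend[OF Lam.prems]]
  have "derivable M U r False (\<beta> + \<alpha>) \<Delta> (\<sigma> \<rightarrowtriangle> \<tau>) (\<lambda>\<delta>. H (s \<delta>))"
  proof (rule derivable.Lam)
    show "derivable M U r False (\<beta> + \<eta>) (case_nat (Some \<sigma>) \<Delta>) \<tau> (\<lambda>\<delta>. F (?s \<delta>))"
      using F by blast
    show "H (s \<delta>) = vabs M \<sigma> \<tau> (\<lambda>a. F (?s (case_nat a \<delta>)))" if "\<delta> \<in> valuations M \<Delta>" for \<delta>
      using Lam.hyps(4)[OF substitution_valuations[OF Lam.prems that]] by simp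
  qed (use Lam.hyps plus_ordinal_strict_mono in auto)
  then show ?case ..
next
  case (Graft \<eta> \<Gamma> E F \<alpha> H)
  have "derivable M U r False (\<beta> + \<alpha>) \<Delta> \<iota> (\<lambda>\<delta>. H (s \<delta>))"
  proof (rule derivable.Graft)
    show "derivable M U r False (\<beta> + \<eta>) \<Delta> \<iota> (\<lambda>\<delta>. E (s \<delta>))"
      using Graft.IH(1)[OF Graft.prems] by blast
    show "derivable M U r False (\<beta> + \<eta>) \<Delta> \<iota> (\<lambda>\<delta>. F n (s \<delta>))" for n
      using Graft.IH(2)[OF Graft.prems] by blast
  qed (use Graft.hyps substitution_valuations[OF Graft.prems] plus_ordinal_strict_mono in auto)
  then show ?case ..
next
  case (Leaf d \<Gamma> H \<alpha>)
  have "derivable M U r False (\<beta> + \<alpha>) \<Delta> \<iota> (\<lambda>\<delta>. H (s \<delta>))"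
    using Leaf.hyps substitution_valuations[OF Leaf.prems] by (intro derivable.Leaf) auto
  then show ?case ..
qed

section \<open>Cut elimination\<close>

text \<open>A non-neutral \<open>App\<close> is a cut of level at most \<open>r\<close>, and the
  level of its result type is no larger. \<open>Coerce\<close>, \<open>Graft\<close> and
  \<open>Leaf\<close> conclude at \<iota>, and \<open>Var\<close> is neutral, so only
  \<open>Lam\<close> remains.\<close>

lemma derivable_Fun_cases:
  assumes "derivable M U r False \<alpha> \<Gamma> (\<sigma> \<rightarrowtriangle> \<tau>) H" "r < lev (\<sigma> \<rightarrowtriangle> \<tau>)"
  obtains \<beta> F where "\<beta> < \<alpha>" "derivable M U r False \<beta> (case_nat (Some \<sigma>) \<Gamma>) \<tau> F"
    "\<And>\<gamma>. \<gamma> \<in> valuations M \<Gamma> \<Longrightarrow> H \<gamma> = vabs M \<sigma> \<tau> (\<lambda>a. F (case_nat a \<gamma>))"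
  using assms(1)
proof cases
  case (App \<beta> \<rho> F G)
  with assms(2) show ?thesis by (auto simp: less_max_iff_disj)
qed (use that in auto)

text \<open>Variable 0 is sent to \<open>G\<close> and every other variable to itself. For a
  non-neutral judgement both alternatives of \<open>derivable_subst\<close> coincide.\<close>

lemma derivable_beta:
  assumes F: "derivable M U r False \<beta> (case_nat (Some \<sigma>) \<Gamma>) \<tau> F"
    and G: "derivable M U r False \<eta> \<Gamma> \<sigma> G" and lev: "lev \<sigma> \<le> r"
  shows "derivable M U r False (\<eta> + \<beta>) \<Gamma> \<tau> (\<lambda>\<gamma>. F (case_nat (G \<gamma>) \<gamma>))"
proof -
  have "substitution M U r \<eta> (case_nat (Some \<sigma>) \<Gamma>) \<Gamma> (\<lambda>\<gamma>. case_nat (G \<gamma>) \<gamma>)"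
    using G lev by (auto simp: substitution_def split: nat.splits)
  from derivable_subst[OF F this] show ?thesis by blast
qed

text \<open>Only cuts of level exactly \<open>Suc r\<close> have to go. Their head ends in
  \<open>Lam\<close>, so they can be contracted; every other rule is kept, with its heights
  exponentiated.\<close>

lemma derivable_reduce_rank:
  "derivable M U (Suc r) ne \<alpha> \<Gamma> \<tau> H \<Longrightarrow> derivable M U r ne (2 \<up> \<alpha>) \<Gamma> \<tau> H"
proof (induction rule: derivable.induct)
  case (Var \<Gamma> i \<sigma> H \<alpha>)
  then show ?case by (rule derivable.Var)
next
  case (App ne \<beta> \<Gamma> \<sigma> \<tau> F G \<alpha> H)
  show ?case
  proof (cases "ne \<or> lev (\<sigma> \<rightarrowtriangle> \<tau>) \<le> r")
    case True
    show ?thesis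
      using App.IH App.hyps(3) True two_opow_strict_mono[OF App.hyps(5)] App.hyps(6)
      by (rule derivable.App)
  next
    case False
    then have "r < lev (\<sigma> \<rightarrowtriangle> \<tau>)" and [simp]: "ne = False" by auto
    from App.IH(1) obtain \<eta> P where \<eta>: "\<eta> < 2 \<up> \<beta>"
      and P: "derivable M U r False \<eta> (case_nat (Some \<sigma>) \<Gamma>) \<tau> P"
      and F: "\<And>\<gamma>. \<gamma> \<in> valuations M \<Gamma> \<Longrightarrow> F \<gamma> = vabs M \<sigma> \<tau> (\<lambda>a. P (case_nat a \<gamma>))"
      unfolding \<open>ne = False\<close> using derivable_Fun_cases[OF _ \<open>r < lev (\<sigma> \<rightarrowtriangle> \<tau>)\<close>] by metis
    \<comment> \<open>The argument type lies below the cut type in level, so the substitution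
      creates only cuts that rank \<open>r\<close> allows.\<close>
    have "lev \<sigma> \<le> r" using False App.hyps(4) by simp
    from derivable_beta[OF P App.IH(2) this] show ?thesis
      unfolding \<open>ne = False\<close>
    proof (rule derivable_mono)
      \<comment> \<open>The argument contributes \<open>2 \<up> \<beta>\<close> and the body of the
        abstraction \<eta>, which is less than \<open>2 \<up> \<beta>\<close>.\<close>
      show "2 \<up> \<beta> + \<eta> \<le> 2 \<up> \<alpha>"
        using plus_ordinal_strict_mono[OF \<eta>, of "2 \<up> \<beta>"] two_opow_double[OF App.hyps(5)] by simp
      show "H \<gamma> = P (case_nat (G \<gamma>) \<gamma>)" if \<gamma>: "\<gamma> \<in> valuations M \<Gamma>" for \<gamma>
      proof -
        have "ap M (vabs M \<sigma> \<tau> (\<lambda>a. P (case_nat a \<gamma>))) (G \<gamma>) = P (case_nat (G \<gamma>) \<gamma>)"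
          using App.hyps(3) \<gamma> derivable_in_car[OF P] derivable_in_car[OF App.IH(2)]
          by (intro ap_vabs[OF M]) (auto simp: U valuations_extend_iff)
        then show ?thesis using App.hyps(6) F \<gamma> by simp
      qed
    qed
  qed
next
  case (Coerce \<alpha> \<Gamma> H)
  show ?case using Coerce.IH by (rule derivable.Coerce)
next
  case (Lam \<beta> \<sigma> \<Gamma> \<tau> F \<alpha> H)
  show ?case
    using Lam.IH Lam.hyps(2) two_opow_strict_mono[OF Lam.hyps(3)] Lam.hyps(4)
    by (rule derivable.Lam)
next
  case (Graft \<beta> \<Gamma> E F \<alpha> H)
  show ?case
    using Graft.IH two_opow_strict_mono[OF Graft.hyps(3)] Graft.hyps(4)
    by (rule derivable.Graft)
next
  case (Leaf d \<Gamma> H \<alpha>)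
  then show ?case by (rule derivable.Leaf)
qed

lemma derivable_reduce_ranks:
  "derivable M U (n + r) ne \<alpha> \<Gamma> \<tau> H \<Longrightarrow> derivable M U r ne (E2 n \<alpha>) \<Gamma> \<tau> H"
proof (induction n arbitrary: r)
  case (Suc n)
  then have "derivable M U (Suc r) ne (E2 n \<alpha>) \<Gamma> \<tau> H" by simp
  then show ?case unfolding E2.simps by (rule derivable_reduce_rank)
qed simp

section \<open>Heights of closed derivations of rank 0\<close>

text \<open>Without variables nothing is neutral, which excludes \<open>Var\<close>,
  \<open>Coerce\<close> and neutral \<open>App\<close>. A cut needs a function type of level 0, and
  there is none. \<open>Lam\<close> leaves the empty context, but nothing is claimed at function
  types. So only \<open>Graft\<close> and \<open>Leaf\<close> matter.\<close>

lemma height_unleaf_le: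
  assumes "derivable M U 0 ne \<alpha> (\<lambda>_. None) \<tau> H"
  shows "\<not> ne \<and> (\<tau> = \<iota> \<longrightarrow> height (unleaf M (H \<gamma>)) \<le> 2 \<up> \<alpha>)"
  using assms
proof (induction ne \<alpha> "\<lambda>_ :: nat. None :: ty option" \<tau> H rule: derivable.induct)
  case (Graft \<beta> E F \<alpha> H)
  have "\<gamma> \<in> valuations M (\<lambda>_. None)" by (simp add: valuations_def)
  then have "height (unleaf M (H \<gamma>)) = height (graft (unleaf M (E \<gamma>)) (\<lambda>n. unleaf M (F n \<gamma>)))"
    using Graft.hyps unleaf_leaf[OF M] by simp
  also have "\<dots> \<le> 2 \<up> \<beta> + height (unleaf M (E \<gamma>))"
    using Graft.hyps by (intro height_graft_le) auto
  also have "\<dots> \<le> 2 \<up> \<beta> + 2 \<up> \<beta>"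
    using Graft.hyps by (intro plus_ordinal_mono_right) auto
  also have "\<dots> \<le> 2 \<up> \<alpha>"
    using Graft.hyps by (intro two_opow_double)
  finally show ?case by simp
next
  case (Leaf d H \<alpha>)
  have "\<gamma> \<in> valuations M (\<lambda>_. None)" by (simp add: valuations_def)
  moreover have "1 \<le> 2 \<up> \<alpha>"
    using zero_less_two_opow[of \<alpha>] by (simp add: one_ordinal_eq osucc_le_iff)
  ultimately show ?case
    using Leaf.hyps unleaf_leaf[OF M] by (auto intro: order_trans)
qed auto

section \<open>Derivations of the interpretation\<close>

text \<open>One step of eta expansion: the result is again neutral, so it can be applied further.
  The fresh variable comes as a non-neutral judgement \<open>x\<close> because \<open>App\<close>
  takes only such arguments.\<close>

lemma derivable_weaken_app:
  assumes F: "derivable M U r True (ord_of_nat m) \<Gamma> (\<sigma> \<rightarrowtriangle> \<tau>) F" and U': "\<sigma> \<rightarrowtriangle> \<tau> \<in> U"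
    and x: "derivable M U r False (ord_of_nat n) (case_nat (Some \<sigma>) \<Gamma>) \<sigma> (\<lambda>\<delta>. \<delta> 0)"
  shows "derivable M U r True (ord_of_nat (Suc (max m n))) (case_nat (Some \<sigma>) \<Gamma>) \<tau>
    (\<lambda>\<delta>. ap M (F (\<delta> \<circ> Suc)) (\<delta> 0))"
proof (rule derivable.App)
  show "derivable M U r True (ord_of_nat (max m n)) (case_nat (Some \<sigma>) \<Gamma>) (\<sigma> \<rightarrowtriangle> \<tau>) (\<lambda>\<delta>. F (\<delta> \<circ> Suc))"
    using derivable_weaken[OF F] by (rule derivable_mono) (simp_all add: ord_of_nat_mono)
  show "derivable M U r False (ord_of_nat (max m n)) (case_nat (Some \<sigma>) \<Gamma>) \<sigma> (\<lambda>\<delta>. \<delta> 0)"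
    using x by (rule derivable_mono) (simp_all add: ord_of_nat_mono)
qed (simp_all add: U' plus_one_ordinal)

text \<open>Only at \<iota> does \<open>Coerce\<close> make a neutral judgement general. At a
  function type, apply it to the expanded fresh variable, expand the result and abstract; this uses
  no cuts and costs finite height.\<close>

lemma derivable_eta_expand:
  assumes "derivable M U r True (ord_of_nat n) \<Gamma> \<tau> F" "\<tau> \<in> U"
  shows "\<exists>m. derivable M U r False (ord_of_nat m) \<Gamma> \<tau> F"
  using assms
proof (induction \<tau> arbitrary: n \<Gamma> F)
  case Iota
  then show ?case by (blast intro: derivable.Coerce)
next
  case (Fun \<sigma> \<tau>)
  have "derivable M U r True (ord_of_nat 0) (case_nat (Some \<sigma>) \<Gamma>) \<sigma> (\<lambda>\<delta>. \<delta> 0)"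
    by (rule derivable.Var[of _ 0]) simp_all
  from Fun.IH(1)[OF this U_FunD(1)[OF Fun.prems(2)]]
  obtain k where "derivable M U r False (ord_of_nat k) (case_nat (Some \<sigma>) \<Gamma>) \<sigma> (\<lambda>\<delta>. \<delta> 0)" ..
  from Fun.IH(2)[OF derivable_weaken_app[OF Fun.prems this] U_FunD(2)[OF Fun.prems(2)]]
  obtain m where "derivable M U r False (ord_of_nat m) (case_nat (Some \<sigma>) \<Gamma>) \<tau>
      (\<lambda>\<delta>. ap M (F (\<delta> \<circ> Suc)) (\<delta> 0))" ..
  then have "derivable M U r False (ord_of_nat (Suc m)) \<Gamma> (\<sigma> \<rightarrowtriangle> \<tau>) F"
    using Fun.prems derivable_in_car[OF Fun.prems(1)]
    by (intro derivable.Lam) (auto simp: plus_one_ordinal vabs_ap)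
  then show ?case ..
qed

lemma derivable_Var_eta:
  assumes "\<Gamma> i = Some \<sigma>" "\<sigma> \<in> U"
  shows "\<exists>n. derivable M U r False (ord_of_nat n) \<Gamma> \<sigma> (\<lambda>\<gamma>. \<gamma> i)"
  using assms by (intro derivable_eta_expand[of r 0] derivable.Var) auto

text \<open>Typed grafting is one \<open>Graft\<close> under \<open>arity \<sigma>\<close>
  abstractions. The branches \<open>F k\<close> are neutral, so applying them to the abstracted
  variables creates no cuts.\<close>

lemma derivable_tgraft:
  assumes "derivable M U r False (ord_of_nat n) \<Gamma> \<iota> E" "\<sigma> \<in> U"
    and "\<And>k. \<exists>n. derivable M U r True (ord_of_nat n) \<Gamma> \<sigma> (F k)"
  shows "derivable M U r False (\<omega> + ord_of_nat (Suc (arity \<sigma>))) \<Gamma> \<sigma>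
    (\<lambda>\<gamma>. tgraft M \<sigma> (unleaf M (E \<gamma>)) (\<lambda>k. F k \<gamma>))"
  using assms
proof (induction \<sigma> arbitrary: n \<Gamma> E F)
  case Iota
  show ?case
  \<comment> \<open>The heights of the branches are finite but need not be bounded uniformly in
    \<open>k\<close>; \<omega> is the common bound that \<open>Graft\<close> demands.\<close>
  proof (rule derivable.Graft[where \<beta> = \<omega> and E = E and F = F])
    show "derivable M U r False \<omega> \<Gamma> \<iota> E"
      using Iota.prems(1) ord_of_nat_le_omega by (rule derivable_mono) simp
    show "derivable M U r False \<omega> \<Gamma> \<iota> (F k)" for k
    proof -
      obtain j where "derivable M U r True (ord_of_nat j) \<Gamma> \<iota> (F k)"
        using Iota.prems(3) by blast
      from derivable.Coerce[OF this] ord_of_nat_le_omega show ?thesis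
        by (rule derivable_mono) simp
    qed
  qed (simp_all add: plus_one_ordinal plus_ordinal_osucc)
next
  case (Fun \<sigma> \<tau>)
  obtain j where j: "derivable M U r False (ord_of_nat j) (case_nat (Some \<sigma>) \<Gamma>) \<sigma> (\<lambda>\<delta>. \<delta> 0)"
    using derivable_Var_eta[of "case_nat (Some \<sigma>) \<Gamma>" 0 \<sigma> r] U_FunD(1)[OF Fun.prems(2)] by auto
  have "\<exists>n. derivable M U r True (ord_of_nat n) (case_nat (Some \<sigma>) \<Gamma>) \<tau>
      (\<lambda>\<delta>. ap M (F k (\<delta> \<circ> Suc)) (\<delta> 0))" for k
    using Fun.prems(3)[of k] derivable_weaken_app[OF _ Fun.prems(2) j] by blast
  note IH = Fun.IH(2)[OF derivable_weaken[OF Fun.prems(1)] U_FunD(2)[OF Fun.prems(2)] this]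
  show ?case
    using IH Fun.prems(2) by (rule derivable.Lam) (auto intro: omega_plus_strict_mono simp del: ord_of_nat.simps)
qed

text \<open>The iterates are unfolded separately for each numeral: each is headed by a variable, the
  step function or the start value, so it is neutral and of finite height. In
  \<open>?\<Delta>\<close> the indices 0, 1, 2 are the recursion argument, the start value and the
  step function.\<close>

lemma derivable_Rec:
  assumes Rec: "const_ty (Rec \<sigma>) \<in> U"
  shows "derivable M U r False (\<omega> + ord_of_nat (const_offset (Rec \<sigma>))) \<Gamma> (const_ty (Rec \<sigma>))
    (\<lambda>_. const_sem M (Rec \<sigma>))"
proof -
  have types: "(\<iota> \<rightarrowtriangle> \<sigma> \<rightarrowtriangle> \<sigma>) \<rightarrowtriangle> \<sigma> \<rightarrowtriangle> \<iota> \<rightarrowtriangle> \<sigma> \<in> U" "\<sigma> \<rightarrowtriangle> \<iota> \<rightarrowtriangle> \<sigma> \<in> U" "\<iota> \<rightarrowtriangle> \<sigma> \<in> U"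
    "\<iota> \<rightarrowtriangle> \<sigma> \<rightarrowtriangle> \<sigma> \<in> U" "\<sigma> \<rightarrowtriangle> \<sigma> \<in> U" "\<sigma> \<in> U" "\<iota> \<in> U"
    using Rec by (auto dest: U_FunD)
  let ?\<Delta> = "case_nat (Some \<iota>) (case_nat (Some \<sigma>) (case_nat (Some (\<iota> \<rightarrowtriangle> \<sigma> \<rightarrowtriangle> \<sigma>)) \<Gamma>))"
  let ?v = "\<lambda>k (\<delta> :: nat \<Rightarrow> 'v).
    rec_nat (\<delta> (Suc 0)) (\<lambda>n v. ap M (ap M (\<delta> (Suc (Suc 0))) (leaf M (Eta n))) v) k"
  have d: "derivable M U r False (ord_of_nat 0) ?\<Delta> \<iota> (\<lambda>\<delta>. \<delta> 0)"
    by (intro derivable.Coerce derivable.Var[where i = 0]) auto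
  have v: "\<exists>n. derivable M U r True (ord_of_nat n) ?\<Delta> \<sigma> (?v k)" for k
  proof (induction k)
    case 0
    have "derivable M U r True (ord_of_nat 0) ?\<Delta> \<sigma> (?v 0)"
      by (intro derivable.Var[where i = "Suc 0"]) auto
    then show ?case ..
  next
    case (Suc k)
    then obtain n where n: "derivable M U r False (ord_of_nat n) ?\<Delta> \<sigma> (?v k)"
      using derivable_eta_expand types(6) by blast
    have "derivable M U r True (ord_of_nat 0) ?\<Delta> (\<iota> \<rightarrowtriangle> \<sigma> \<rightarrowtriangle> \<sigma>) (\<lambda>\<delta>. \<delta> (Suc (Suc 0)))"
      by (intro derivable.Var[where i = "Suc (Suc 0)"]) auto
    moreover have "derivable M U r False (ord_of_nat 0) ?\<Delta> \<iota> (\<lambda>\<delta>. leaf M (Eta k))"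
      by (rule derivable.Leaf[of "Eta k"]) auto
    ultimately have "derivable M U r True (ord_of_nat (Suc n)) ?\<Delta> (\<sigma> \<rightarrowtriangle> \<sigma>)
        (\<lambda>\<delta>. ap M (\<delta> (Suc (Suc 0))) (leaf M (Eta k)))"
      by (rule derivable.App) (auto intro: ord_of_nat_strict_mono types simp del: ord_of_nat.simps)
    moreover have "derivable M U r False (ord_of_nat (Suc n)) ?\<Delta> \<sigma> (?v k)"
      using n by (rule derivable_mono) (auto intro: ord_of_nat_mono simp del: ord_of_nat.simps)
    ultimately have "derivable M U r True (ord_of_nat (Suc (Suc n))) ?\<Delta> \<sigma> (?v (Suc k))"
      by (rule derivable.App) (auto intro: ord_of_nat_strict_mono types simp del: ord_of_nat.simps)
    then show ?case ..
  qed
  have 1: "derivable M U r False (\<omega> + ord_of_nat (arity \<sigma> + 1)) ?\<Delta> \<sigma>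
      (\<lambda>\<delta>. tgraft M \<sigma> (unleaf M (\<delta> 0)) (\<lambda>k. ?v k \<delta>))"
    using derivable_tgraft[OF d types(6) v] by simp
  have 2: "derivable M U r False (\<omega> + ord_of_nat (arity \<sigma> + 2))
      (case_nat (Some \<sigma>) (case_nat (Some (\<iota> \<rightarrowtriangle> \<sigma> \<rightarrowtriangle> \<sigma>)) \<Gamma>)) (\<iota> \<rightarrowtriangle> \<sigma>)
      (\<lambda>\<delta>. vabs M \<iota> \<sigma> (\<lambda>d. tgraft M \<sigma> (unleaf M d)
        (rec_nat (\<delta> 0) (\<lambda>n v. ap M (ap M (\<delta> (Suc 0)) (leaf M (Eta n))) v))))"
    using 1 types(3) omega_plus_strict_mono by (rule derivable.Lam) simp_all
  have 3: "derivable M U r False (\<omega> + ord_of_nat (arity \<sigma> + 3))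
      (case_nat (Some (\<iota> \<rightarrowtriangle> \<sigma> \<rightarrowtriangle> \<sigma>)) \<Gamma>) (\<sigma> \<rightarrowtriangle> \<iota> \<rightarrowtriangle> \<sigma>)
      (\<lambda>\<delta>. vabs M \<sigma> (\<iota> \<rightarrowtriangle> \<sigma>) (\<lambda>a. vabs M \<iota> \<sigma> (\<lambda>d. tgraft M \<sigma> (unleaf M d)
        (rec_nat a (\<lambda>n v. ap M (ap M (\<delta> 0) (leaf M (Eta n))) v)))))"
    using 2 types(2) omega_plus_strict_mono by (rule derivable.Lam) simp_all
  \<comment> \<open>\<open>Lam\<close> asks only for a strict increase, so the height may jump from
    \<open>arity \<sigma> + 3\<close> to the offset of \<open>Rec \<sigma>\<close>.\<close>
  have "derivable M U r False (\<omega> + ord_of_nat (2 * arity \<sigma> + 4)) \<Gamma>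
      ((\<iota> \<rightarrowtriangle> \<sigma> \<rightarrowtriangle> \<sigma>) \<rightarrowtriangle> \<sigma> \<rightarrowtriangle> \<iota> \<rightarrowtriangle> \<sigma>) (\<lambda>_. const_sem M (Rec \<sigma>))"
    using 3 types(1) omega_plus_strict_mono by (rule derivable.Lam) simp_all
  then show ?thesis by simp
qed

text \<open>This serves both \<open>Succ\<close>, where \<open>g n\<close> is a leaf, and
  \<open>gen\<close>, where \<open>g n\<close> is a single query. The latter is why
  \<open>Leaf\<close> admits trees of height 1.\<close>

lemma derivable_graft_leaf:
  assumes "\<iota> \<rightarrowtriangle> \<iota> \<in> U" "\<And>n. height (g n) \<le> 1"
  shows "derivable M U r False (ord_of_nat 2) \<Gamma> (\<iota> \<rightarrowtriangle> \<iota>)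
    (\<lambda>_. vabs M \<iota> \<iota> (\<lambda>d. leaf M (graft (unleaf M d) g)))"
proof -
  let ?\<Delta> = "case_nat (Some \<iota>) \<Gamma>"
  have "derivable M U r False (ord_of_nat 0) ?\<Delta> \<iota> (\<lambda>\<delta>. \<delta> 0)"
    by (intro derivable.Coerce derivable.Var[where i = 0]) auto
  moreover have "derivable M U r False (ord_of_nat 0) ?\<Delta> \<iota> (\<lambda>\<delta>. leaf M (g n))" for n
    using assms(2) by (rule derivable.Leaf) simp
  ultimately have "derivable M U r False (ord_of_nat 1) ?\<Delta> \<iota> (\<lambda>\<delta>. leaf M (graft (unleaf M (\<delta> 0)) g))"
    using ord_of_nat_strict_mono by (rule derivable.Graft) (simp_all add: unleaf_leaf[OF M])
  then show ?thesis
    using assms(1) ord_of_nat_strict_mono by (rule derivable.Lam) simp_all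
qed

lemma derivable_const_sem:
  assumes "const_ty c \<in> U"
  shows "derivable M U r False (\<omega> + ord_of_nat (const_offset c)) \<Gamma> (const_ty c) (\<lambda>_. const_sem M c)"
proof (cases c)
  case Zero
  then show ?thesis by (auto intro: derivable.Leaf[of "Eta 0"])
next
  case Succ
  have "derivable M U r False (ord_of_nat 2) \<Gamma> (\<iota> \<rightarrowtriangle> \<iota>)
      (\<lambda>_. vabs M \<iota> \<iota> (\<lambda>d. leaf M (graft (unleaf M d) (\<lambda>n. Eta (n + 1)))))"
    using assms Succ by (intro derivable_graft_leaf) auto
  then have "derivable M U r False (\<omega> + ord_of_nat 2) \<Gamma> (\<iota> \<rightarrowtriangle> \<iota>) (\<lambda>_. const_sem M Succ)"
    using ord_of_nat_le_omega_plus by (rule derivable_mono) (simp add: dmap_def)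
  then show ?thesis using Succ by simp
next
  case (Rec \<sigma>)
  then show ?thesis using derivable_Rec assms by simp
qed

section \<open>From typed terms to derivations\<close>

definition ctx :: "ty list \<Rightarrow> nat \<Rightarrow> ty option" where
  "ctx \<Gamma> i = (if i < length \<Gamma> then Some (\<Gamma> ! i) else None)"

lemma ctx_Cons: "ctx (\<sigma> # \<Gamma>) = case_nat (Some \<sigma>) (ctx \<Gamma>)"
  by (auto simp: ctx_def fun_eq_iff split: nat.split)

text \<open>In an application the cut type is the type of the function part, so the ceiling of that
  part bounds the level of the cut.\<close>

lemma type_of_le_src_ceiling:
  "has_type const_ty \<Gamma> t \<tau> \<Longrightarrow>
    type_of xconst_ty \<Gamma> (map_tm Src t) = \<tau> \<and> lev \<tau> \<le> src_ceiling \<Gamma> (map_tm Src t)"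
proof (induction rule: has_type.induct)
  case (Const \<Gamma> c)
  then show ?case by (cases c) auto
qed auto

lemma derivable_sem:
  "has_type const_ty \<Gamma> t \<tau> \<Longrightarrow> types_in \<Gamma> t \<subseteq> U \<Longrightarrow> src_ceiling \<Gamma> (map_tm Src t) \<le> r \<Longrightarrow>
    derivable M U r False (\<omega> + ord_of_nat (src_offset (map_tm Src t))) (ctx \<Gamma>) \<tau>
      (\<lambda>\<gamma>. sem M \<Gamma> (map \<gamma> [0..<length \<Gamma>]) t)"
proof (induction rule: has_type.induct)
  case (Var i \<Gamma>)
  \<comment> \<open>The finite cost of eta expansion is absorbed by \<omega>, in accordance with the
    offset 0 of variables.\<close>
  then obtain n where "derivable M U r False (ord_of_nat n) (ctx \<Gamma>) (\<Gamma> ! i) (\<lambda>\<gamma>. \<gamma> i)"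
    using derivable_Var_eta[of "ctx \<Gamma>" i "\<Gamma> ! i" r] by (auto simp: ctx_def)
  then show ?case
    using ord_of_nat_le_omega_plus by (rule derivable_mono) (simp add: Var.hyps)
next
  case (Lam \<sigma> \<Gamma> u \<tau>)
  note ty = has_type_type_of[OF Lam.hyps]
  have "derivable M U r False (\<omega> + ord_of_nat (src_offset (map_tm Src u))) (case_nat (Some \<sigma>) (ctx \<Gamma>)) \<tau>
      (\<lambda>\<gamma>. sem M (\<sigma> # \<Gamma>) (map \<gamma> [0..<length (\<sigma> # \<Gamma>)]) u)"
    using Lam by (simp add: ctx_Cons del: upt_Suc)
  moreover have "\<sigma> \<rightarrowtriangle> \<tau> \<in> U"
    using Lam.prems ty by simp
  moreover have "\<omega> + ord_of_nat (src_offset (map_tm Src u)) <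
      \<omega> + ord_of_nat (src_offset (map_tm Src (Lam \<sigma> u)))"
    by (intro omega_plus_strict_mono) simp
  ultimately show ?case
    by (rule derivable.Lam) (simp add: ty map_upt_Suc del: upt_Suc)
next
  case (App \<Gamma> u \<sigma> \<tau> v)
  let ?u = "map_tm Src u" and ?v = "map_tm Src v"
  let ?m = "max (src_offset ?u) (src_offset ?v)"
  have "derivable M U r False (\<omega> + ord_of_nat ?m) (ctx \<Gamma>) (\<sigma> \<rightarrowtriangle> \<tau>)
      (\<lambda>\<gamma>. sem M \<Gamma> (map \<gamma> [0..<length \<Gamma>]) u)"
    using App by (intro derivable_mono[OF App.IH(1)] omega_plus_mono) auto
  moreover have "derivable M U r False (\<omega> + ord_of_nat ?m) (ctx \<Gamma>) \<sigma>
      (\<lambda>\<gamma>. sem M \<Gamma> (map \<gamma> [0..<length \<Gamma>]) v)"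
    using App by (intro derivable_mono[OF App.IH(2)] omega_plus_mono) auto
  moreover have "\<sigma> \<rightarrowtriangle> \<tau> \<in> U"
    using type_in_types_in[of \<Gamma> u] has_type_type_of[OF App.hyps(1)] App.prems(1) by auto
  moreover have "False \<or> lev (\<sigma> \<rightarrowtriangle> \<tau>) \<le> r"
    using type_of_le_src_ceiling[OF App.hyps(1)] App.prems(2) by auto
  moreover have "\<omega> + ord_of_nat ?m < \<omega> + ord_of_nat (src_offset (map_tm Src (App u v)))"
    by (intro omega_plus_strict_mono) simp
  ultimately show ?case
    by (rule derivable.App) simp
next
  case (Const \<Gamma> c)
  then show ?case using derivable_const_sem by simp
qed

lemma derivable_D_of:
  assumes t: "has_type const_ty [] t ((\<iota> \<rightarrowtriangle> \<iota>) \<rightarrowtriangle> \<iota>)" and types: "types_in [] t \<subseteq> U"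
  shows "derivable M U (K_of t) False (\<omega> + ord_of_nat (m_of t)) (\<lambda>_. None) \<iota> (\<lambda>_. leaf M (D_of M t))"
proof -
  let ?t = "map_tm Src t" and ?gen = "vabs M \<iota> \<iota> (\<lambda>d. leaf M (gen (unleaf M d)))"
  \<comment> \<open>Here 3 is the offset of \<open>Omega\<close>, so \<open>m_of t\<close> is
    \<open>?m + 1\<close>.\<close>
  let ?m = "max (src_offset ?t) 3"
  have U': "(\<iota> \<rightarrowtriangle> \<iota>) \<rightarrowtriangle> \<iota> \<in> U"
    using type_in_types_in[of "[]" t] has_type_type_of[OF t] types by auto
  have ceiling: "src_ceiling [] ?t \<le> K_of t"
    by (simp add: K_of_def app_Omega_def)
  have "derivable M U (K_of t) False (\<omega> + ord_of_nat (src_offset ?t)) (\<lambda>_. None) ((\<iota> \<rightarrowtriangle> \<iota>) \<rightarrowtriangle> \<iota>)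
      (\<lambda>_. sem M [] [] t)"
    using derivable_sem[OF t types ceiling] by (simp add: ctx_def[abs_def])
  then have t': "derivable M U (K_of t) False (\<omega> + ord_of_nat ?m) (\<lambda>_. None) ((\<iota> \<rightarrowtriangle> \<iota>) \<rightarrowtriangle> \<iota>)
      (\<lambda>_. sem M [] [] t)"
    by (rule derivable_mono) (simp_all add: omega_plus_mono)
  have "derivable M U (K_of t) False (ord_of_nat 2) (\<lambda>_. None) (\<iota> \<rightarrowtriangle> \<iota>) (\<lambda>_. ?gen)"
    unfolding gen_def using U_FunD(1)[OF U']
    by (rule derivable_graft_leaf) (simp only: height_Beta_le_iff, simp)
  then have gen: "derivable M U (K_of t) False (\<omega> + ord_of_nat ?m) (\<lambda>_. None) (\<iota> \<rightarrowtriangle> \<iota>) (\<lambda>_. ?gen)"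
    by (rule derivable_mono) (simp_all add: ord_of_nat_le_omega_plus)
  \<comment> \<open>In the empty context every function is a valuation, so \<open>undefined\<close>
    serves as one.\<close>
  have "leaf M (D_of M t) = ap M (sem M [] [] t) ?gen"
    using derivable_in_car[OF t', of undefined] derivable_in_car[OF gen, of undefined] U' U
    by (auto simp: D_of_def valuations_def intro!: leaf_unleaf[OF M] ap_in[OF M])
  moreover have "\<omega> + ord_of_nat ?m < \<omega> + ord_of_nat (m_of t)"
    by (intro omega_plus_strict_mono) (simp add: m_of_def app_Omega_def)
  moreover have "lev ((\<iota> \<rightarrowtriangle> \<iota>) \<rightarrowtriangle> \<iota>) \<le> K_of t"
    using type_of_le_src_ceiling[OF t] ceiling by simp
  ultimately show ?thesis
    by (intro derivable.App[OF t' gen U']) auto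
qed

end

theorem mainTheorem2:
  fixes t :: "const tm" and M :: "'v type_structure"
  assumes "has_type const_ty [] t ((\<iota> \<rightarrowtriangle> \<iota>) \<rightarrowtriangle> \<iota>)"
    and "full_on M (types_in [] t)"
  shows "height (D_of M t) \<le> E2 (K_of t + 1) (\<omega> + ord_of_nat (m_of t))"
proof -
  let ?U = "\<Union> (subtypes ` types_in [] t)"
  have "types_in [] t \<subseteq> ?U" using subtypes_refl by blast
  from derivable_D_of[OF assms(2) refl assms(1) this]
  have "derivable M ?U (K_of t + 0) False (\<omega> + ord_of_nat (m_of t)) (\<lambda>_. None) \<iota> (\<lambda>_. leaf M (D_of M t))"
    by simp
  \<comment> \<open>Lowering the rank to 0 costs \<open>K_of t\<close> exponentials; reading off the
    tree costs one more.\<close>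
  from derivable_reduce_ranks[OF assms(2) refl this]
  have "derivable M ?U 0 False (E2 (K_of t) (\<omega> + ord_of_nat (m_of t))) (\<lambda>_. None) \<iota>
      (\<lambda>_. leaf M (D_of M t))" .
  from height_unleaf_le[OF assms(2) refl this] show ?thesis
    by (simp add: unleaf_leaf[OF assms(2)])
qed

end
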